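(* Let $G$ be a finitely generated group. Then $\Sigma^1(G)^c$ is a rationally defined spherical polyhedron if and only if $\Sigma^1(\mathfrak{X}(G))^c$ is a rationally defined spherical polyhedron.
   Context: For a group $G$ let $\overline{G}$ be an isomorphic copy of $G$, with $\overline{g}$ the image of $g \in G$, and let $\mathfrak{X}(G) = \langle G, \overline{G} \mid [g, \overline{g}] = 1 \text{ for } g \in G\rangle$. A character of a group $H$ is a non-zero homomorphism $\chi : H \to \mathbb{R}$. Two characters are equivalent if one is a positive real multiple of the other; $[\chi]$ is the equivalence class and $S(H)$ is the set of equivalence classes (the character sphere). Put $H_\chi = \{h \in H \mid \chi(h) \geq 0\}$. For a finitely generated group $H$ with finite generating set $X$, let $\Gamma$ be the Cayley graph (vertices $H$, edges from $h$ to $hx$, $x \in X$), and let $\Gamma_\chi$ be its subgraph spanned by $H_\chi$. Then $\Sigma^1(H) = \{[\chi] \in S(H) \mid \Gamma_\chi \text{ is connected}\}$ (independent of the choice of $X$), and $\Sigma^1(H)^c = S(H) \setminus \Sigma^1(H)$. A subset of $S(H)$ is a rationally defined spherical polyhedron if it is a finite union of finite intersections of closed rationally defined semispheres in $S(H)$, where a closed semisphere is rationally defined if it is defined by a rational vector; i.e., identifying $\mathrm{Hom}(H,\mathbb{R})$ with $\mathbb{R}^n$ via a basis of $H/H'$ modulo torsion $\cong \mathbb{Z}^n$, it has the form $\{[\chi] \mid \langle v, \chi\rangle \geq 0\}$ for some non-zero $v \in \mathbb{Q}^n$. *)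

theory Defs
  imports Complex_Main "HOL-Algebra.Generated_Groups" "HOL-Algebra.FiniteProduct"
    "Graph_Theory.Digraph_Component"
begin

section \<open>The group X(G)\<close>

text \<open>
  Words in the alphabet consisting of \<open>Inl g\<close> (the letter g) and \<open>Inr g\<close> (its copy in the
  isomorphic group), for g in G. Every letter has an inverse letter modulo the multiplication
  table of G, so the monoid presented by the relations below is the group presented by them.
\<close>

definition sidki_words :: "('a, 'b) monoid_scheme \<Rightarrow> ('a + 'a) list set" where
  "sidki_words G = lists (carrier G <+> carrier G)"

inductive_set sidki_cong ::
    "('a, 'b) monoid_scheme \<Rightarrow> (('a + 'a) list \<times> ('a + 'a) list) set"
  for G (structure) where
  refl: "w \<in> sidki_words G \<Longrightarrow> (w, w) \<in> sidki_cong G"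
| sym: "(u, v) \<in> sidki_cong G \<Longrightarrow> (v, u) \<in> sidki_cong G"
| trans: "(u, v) \<in> sidki_cong G \<Longrightarrow> (v, w) \<in> sidki_cong G \<Longrightarrow> (u, w) \<in> sidki_cong G"
| in_context: "(u, v) \<in> sidki_cong G \<Longrightarrow> p \<in> sidki_words G \<Longrightarrow> q \<in> sidki_words G
    \<Longrightarrow> (p @ u @ q, p @ v @ q) \<in> sidki_cong G"
| one_left: "([Inl \<one>], []) \<in> sidki_cong G"
| mult_left: "g \<in> carrier G \<Longrightarrow> h \<in> carrier G \<Longrightarrow> ([Inl g, Inl h], [Inl (g \<otimes> h)]) \<in> sidki_cong G"
| one_right: "([Inr \<one>], []) \<in> sidki_cong G"
| mult_right: "g \<in> carrier G \<Longrightarrow> h \<in> carrier G \<Longrightarrow> ([Inr g, Inr h], [Inr (g \<otimes> h)]) \<in> sidki_cong G"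
| commutator: "g \<in> carrier G \<Longrightarrow> ([Inl g, Inr g, Inl (inv g), Inr (inv g)], []) \<in> sidki_cong G"

definition sidki_class :: "('a, 'b) monoid_scheme \<Rightarrow> ('a + 'a) list \<Rightarrow> ('a + 'a) list set" where
  "sidki_class G w = sidki_cong G `` {w}"

definition sidki :: "('a, 'b) monoid_scheme \<Rightarrow> ('a + 'a) list set monoid" where
  "sidki G = \<lparr>carrier = sidki_words G // sidki_cong G,
     monoid.mult = (\<lambda>A B. \<Union>u\<in>A. \<Union>v\<in>B. sidki_class G (u @ v)),
     one = sidki_class G []\<rparr>"

section \<open>Characters and the character sphere\<close>

definition real_add_group :: "real monoid" where
  "real_add_group = \<lparr>carrier = UNIV, monoid.mult = (+), one = 0\<rparr>"

text \<open>Extensionality makes a character determined by its values on the group.\<close>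

definition characters :: "('a, 'b) monoid_scheme \<Rightarrow> ('a \<Rightarrow> real) set" where
  "characters H = {\<chi> \<in> hom H real_add_group \<inter> extensional (carrier H). \<exists>h\<in>carrier H. \<chi> h \<noteq> 0}"

definition char_equiv :: "('a, 'b) monoid_scheme \<Rightarrow> (('a \<Rightarrow> real) \<times> ('a \<Rightarrow> real)) set" where
  "char_equiv H = {(\<chi>, \<psi>). \<chi> \<in> characters H \<and> \<psi> \<in> characters H \<and>
     (\<exists>r>0. \<forall>h\<in>carrier H. \<psi> h = r * \<chi> h)}"

definition char_sphere :: "('a, 'b) monoid_scheme \<Rightarrow> ('a \<Rightarrow> real) set set" where
  "char_sphere H = characters H // char_equiv H"

definition char_class :: "('a, 'b) monoid_scheme \<Rightarrow> ('a \<Rightarrow> real) \<Rightarrow> ('a \<Rightarrow> real) set" where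
  "char_class H \<chi> = char_equiv H `` {\<chi>}"

section \<open>The first Sigma-invariant\<close>

definition finite_gen_set :: "('a, 'b) monoid_scheme \<Rightarrow> 'a set \<Rightarrow> bool" where
  "finite_gen_set H X \<longleftrightarrow> finite X \<and> X \<subseteq> carrier H \<and> generate H X = carrier H"

definition finitely_generated :: "('a, 'b) monoid_scheme \<Rightarrow> bool" where
  "finitely_generated H \<longleftrightarrow> (\<exists>X. finite_gen_set H X)"

definition cayley_graph :: "('a, 'b) monoid_scheme \<Rightarrow> 'a set \<Rightarrow> ('a, 'a \<times> 'a) pre_digraph" where
  "cayley_graph H X = \<lparr>verts = carrier H, arcs = carrier H \<times> X,
     tail = fst, head = (\<lambda>(h, x). h \<otimes>\<^bsub>H\<^esub> x)\<rparr>"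

definition nonneg_part :: "('a, 'b) monoid_scheme \<Rightarrow> ('a \<Rightarrow> real) \<Rightarrow> 'a set" where
  "nonneg_part H \<chi> = {h \<in> carrier H. \<chi> h \<ge> 0}"

definition cayley_graph_char ::
    "('a, 'b) monoid_scheme \<Rightarrow> 'a set \<Rightarrow> ('a \<Rightarrow> real) \<Rightarrow> ('a, 'a \<times> 'a) pre_digraph" where
  "cayley_graph_char H X \<chi> = cayley_graph H X \<restriction> nonneg_part H \<chi>"

text \<open>
  Connectedness is that of the underlying undirected graph. The choice of the finite generating
  set is immaterial, see \<open>Sigma1_independent\<close> below.
\<close>

definition Sigma1 :: "('a, 'b) monoid_scheme \<Rightarrow> ('a \<Rightarrow> real) set set" where
  "Sigma1 H = {char_class H \<chi> | \<chi>. \<chi> \<in> characters H \<and>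
     (\<exists>X. finite_gen_set H X \<and> Digraph_Component.connected (cayley_graph_char H X \<chi>))}"

definition Sigma1_compl :: "('a, 'b) monoid_scheme \<Rightarrow> ('a \<Rightarrow> real) set set" where
  "Sigma1_compl H = char_sphere H - Sigma1 H"

section \<open>Rationally defined spherical polyhedra\<close>

definition torsion :: "('a, 'b) monoid_scheme \<Rightarrow> 'a set" where
  "torsion A = {a \<in> carrier A. \<exists>n::nat. n > 0 \<and> a [^]\<^bsub>A\<^esub> n = \<one>\<^bsub>A\<^esub>}"

definition abelianization :: "('a, 'b) monoid_scheme \<Rightarrow> 'a set monoid" where
  "abelianization H = H Mod derived H (carrier H)"

definition abel_mod_torsion :: "('a, 'b) monoid_scheme \<Rightarrow> 'a set set monoid" where
  "abel_mod_torsion H = abelianization H Mod torsion (abelianization H)"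

definition abel_mod_torsion_proj :: "('a, 'b) monoid_scheme \<Rightarrow> 'a \<Rightarrow> 'a set set" where
  "abel_mod_torsion_proj H h =
     torsion (abelianization H) #>\<^bsub>abelianization H\<^esub> (derived H (carrier H) #>\<^bsub>H\<^esub> h)"

text \<open>
  The elements \<open>b 0, \<dots>, b (n - 1)\<close> of H represent a basis of H/H' modulo torsion. As a character
  kills H' and has torsion-free image, its coordinates with respect to that basis are its
  values at these representatives.
\<close>

definition abel_basis :: "('a, 'b) monoid_scheme \<Rightarrow> nat \<Rightarrow> (nat \<Rightarrow> 'a) \<Rightarrow> bool" where
  "abel_basis H n b \<longleftrightarrow> (\<forall>i<n. b i \<in> carrier H) \<and>
     (\<forall>q\<in>carrier (abel_mod_torsion H). \<exists>!k. k \<in> {..<n} \<rightarrow>\<^sub>E (UNIV :: int set) \<and>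
        q = finprod (abel_mod_torsion H)
              (\<lambda>i. abel_mod_torsion_proj H (b i) [^]\<^bsub>abel_mod_torsion H\<^esub> k i) {..<n})"

definition rational_semisphere :: "('a, 'b) monoid_scheme \<Rightarrow> ('a \<Rightarrow> real) set set \<Rightarrow> bool" where
  "rational_semisphere H S \<longleftrightarrow> (\<exists>n b. \<exists>v :: nat \<Rightarrow> rat. abel_basis H n b \<and> (\<exists>i<n. v i \<noteq> 0) \<and>
     S = {char_class H \<chi> | \<chi>. \<chi> \<in> characters H \<and> (\<Sum>i<n. of_rat (v i) * \<chi> (b i)) \<ge> 0})"

definition rational_polyhedron :: "('a, 'b) monoid_scheme \<Rightarrow> ('a \<Rightarrow> real) set set \<Rightarrow> bool" where
  "rational_polyhedron H P \<longleftrightarrow> (\<exists>F. finite F \<and>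
     (\<forall>I\<in>F. finite I \<and> (\<forall>S\<in>I. rational_semisphere H S)) \<and>
     P = (\<Union>I\<in>F. char_sphere H \<inter> \<Inter>I))"

section \<open>X(G) is a finitely generated group\<close>

lemma sidki_words_simps [simp]:
  "[] \<in> sidki_words G"
  "u @ v \<in> sidki_words G \<longleftrightarrow> u \<in> sidki_words G \<and> v \<in> sidki_words G"
  "Inl g # u \<in> sidki_words G \<longleftrightarrow> g \<in> carrier G \<and> u \<in> sidki_words G"
  "Inr g # u \<in> sidki_words G \<longleftrightarrow> g \<in> carrier G \<and> u \<in> sidki_words G"
  by (auto simp: sidki_words_def)

lemma sidki_cong_words:
  assumes "group G" "(u, v) \<in> sidki_cong G"
  shows "u \<in> sidki_words G \<and> v \<in> sidki_words G"
proof -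
  interpret group G by fact
  show ?thesis using assms(2) by (induction) auto
qed

lemma sidki_cong_equiv:
  assumes "group G"
  shows "equiv (sidki_words G) (sidki_cong G)"
proof (rule equivI)
  show "sidki_cong G \<subseteq> sidki_words G \<times> sidki_words G"
    using sidki_cong_words[OF assms] by auto
  show "refl_on (sidki_words G) (sidki_cong G)"
    by (auto simp: refl_on_def sidki_cong.refl)
  show "Relation.sym (sidki_cong G)"
    by (auto intro: symI sidki_cong.sym)
  show "Relation.trans (sidki_cong G)"
    by (rule transI) (rule sidki_cong.trans)
qed

lemma sidki_cong_append:
  assumes "group G" and u: "(u, u') \<in> sidki_cong G" and v: "(v, v') \<in> sidki_cong G"
  shows "(u @ v, u' @ v') \<in> sidki_cong G"
proof -
  note w = sidki_cong_words[OF assms(1) u] sidki_cong_words[OF assms(1) v]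
  have "(u @ v, u' @ v) \<in> sidki_cong G"
    using sidki_cong.in_context[OF u, of "[]" v] w by simp
  moreover have "(u' @ v, u' @ v') \<in> sidki_cong G"
    using sidki_cong.in_context[OF v, of u' "[]"] w by simp
  ultimately show ?thesis by (rule sidki_cong.trans)
qed

lemma sidki_class_eq:
  assumes "group G" "u \<in> sidki_words G" "v \<in> sidki_words G"
  shows "sidki_class G u = sidki_class G v \<longleftrightarrow> (u, v) \<in> sidki_cong G"
  unfolding sidki_class_def
  using eq_equiv_class_iff[OF sidki_cong_equiv[OF assms(1)] assms(2,3)] .

lemma sidki_mult:
  assumes "group G" "u \<in> sidki_words G" "v \<in> sidki_words G"
  shows "sidki_class G u \<otimes>\<^bsub>sidki G\<^esub> sidki_class G v = sidki_class G (u @ v)"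
proof -
  have eq: "sidki_class G (u' @ v') = sidki_class G (u @ v)"
    if "u' \<in> sidki_class G u" "v' \<in> sidki_class G v" for u' v'
  proof -
    have "(u, u') \<in> sidki_cong G" "(v, v') \<in> sidki_cong G"
      using that by (auto simp: sidki_class_def)
    from sidki_cong_append[OF assms(1) this] have "(u @ v, u' @ v') \<in> sidki_cong G" .
    thus ?thesis
      using sidki_class_eq[OF assms(1)] sidki_cong_words[OF assms(1)] by blast
  qed
  have "u \<in> sidki_class G u" "v \<in> sidki_class G v"
    using assms by (auto simp: sidki_class_def intro: sidki_cong.refl)
  hence "(\<Union>u'\<in>sidki_class G u. \<Union>v'\<in>sidki_class G v. sidki_class G (u' @ v')) = sidki_class G (u @ v)"
    using eq by blast
  thus ?thesis by (simp add: sidki_def)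
qed

lemma sidki_carrier: "carrier (sidki G) = sidki_class G ` sidki_words G"
  by (auto simp: sidki_def quotient_def sidki_class_def)

lemma sidki_one: "\<one>\<^bsub>sidki G\<^esub> = sidki_class G []"
  by (simp add: sidki_def)

lemma sidki_left_inverse:
  fixes G (structure)
  assumes "group G" "w \<in> sidki_words G"
  shows "\<exists>u\<in>sidki_words G. (u @ w, []) \<in> sidki_cong G"
  using assms(2)
proof (induction w)
  case Nil
  show ?case by (rule bexI[of _ "[]"]) (auto intro: sidki_cong.refl)
next
  case (Cons a w)
  interpret group G by fact
  have "w \<in> sidki_words G" using Cons.prems by (auto simp: sidki_words_def)
  with Cons.IH obtain u where u: "u \<in> sidki_words G" "(u @ w, []) \<in> sidki_cong G" by blast
  obtain a' where a': "[a'] \<in> sidki_words G" "([a', a], []) \<in> sidki_cong G"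
  proof (cases a)
    case (Inl g)
    with Cons.prems have g: "g \<in> carrier G" by simp
    have "([Inl (inv g), Inl g], []) \<in> sidki_cong G"
      using sidki_cong.trans[OF sidki_cong.mult_left[of "inv g" G g]] sidki_cong.one_left[of G] g
      by simp
    with Inl g that[of "Inl (inv g)"] show ?thesis by simp
  next
    case (Inr g)
    with Cons.prems have g: "g \<in> carrier G" by simp
    have "([Inr (inv g), Inr g], []) \<in> sidki_cong G"
      using sidki_cong.trans[OF sidki_cong.mult_right[of "inv g" G g]] sidki_cong.one_right[of G] g
      by simp
    with Inr g that[of "Inr (inv g)"] show ?thesis by simp
  qed
  have "(u @ [a', a] @ w, u @ [] @ w) \<in> sidki_cong G"
    by (rule sidki_cong.in_context) (use a' u \<open>w \<in> sidki_words G\<close> in auto)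
  with u(2) have "((u @ [a']) @ a # w, []) \<in> sidki_cong G"
    by (auto intro: sidki_cong.trans)
  thus ?case using u a' by (intro bexI[of _ "u @ [a']"]) auto
qed

lemma sidki_group:
  assumes "group G"
  shows "group (sidki G)"
proof (rule groupI)
  show "\<one>\<^bsub>sidki G\<^esub> \<in> carrier (sidki G)"
    by (auto simp: sidki_one sidki_carrier)
  show "\<exists>y\<in>carrier (sidki G). y \<otimes>\<^bsub>sidki G\<^esub> x = \<one>\<^bsub>sidki G\<^esub>" if x: "x \<in> carrier (sidki G)" for x
  proof -
    obtain w where w: "w \<in> sidki_words G" "x = sidki_class G w"
      using x by (auto simp: sidki_carrier)
    obtain u where u: "u \<in> sidki_words G" "(u @ w, []) \<in> sidki_cong G"
      using sidki_left_inverse[OF assms w(1)] by blast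
    thus ?thesis
      using w by (intro bexI[of _ "sidki_class G u"])
        (auto simp: sidki_carrier sidki_mult[OF assms] sidki_one sidki_class_eq[OF assms])
  qed
qed (auto simp: sidki_carrier sidki_mult[OF assms] sidki_one)

lemma sidki_letter_hom:
  assumes "group G"
  shows "(\<lambda>g. sidki_class G [Inl g]) \<in> hom G (sidki G)"
    and "(\<lambda>g. sidki_class G [Inr g]) \<in> hom G (sidki G)"
proof -
  interpret group G by fact
  show "(\<lambda>g. sidki_class G [Inl g]) \<in> hom G (sidki G)"
    by (rule homI) (auto simp: sidki_carrier sidki_mult[OF assms] sidki_class_eq[OF assms]
        intro: sidki_cong.sym sidki_cong.mult_left)
  show "(\<lambda>g. sidki_class G [Inr g]) \<in> hom G (sidki G)"
    by (rule homI) (auto simp: sidki_carrier sidki_mult[OF assms] sidki_class_eq[OF assms]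
        intro: sidki_cong.sym sidki_cong.mult_right)
qed

lemma sidki_finitely_generated:
  assumes G: "group G" and fg: "finitely_generated G"
  shows "finitely_generated (sidki G)"
proof -
  interpret G: group G by fact
  interpret S: group "sidki G" by (rule sidki_group[OF G])
  obtain X where X: "finite X" "X \<subseteq> carrier G" "generate G X = carrier G"
    using fg by (auto simp: finitely_generated_def finite_gen_set_def)
  define l where "l = (\<lambda>g. sidki_class G [Inl g])"
  define r where "r = (\<lambda>g. sidki_class G [Inr g])"
  interpret l: group_hom G "sidki G" l
    using sidki_letter_hom(1)[OF G] by unfold_locales (simp add: l_def)
  interpret r: group_hom G "sidki G" r
    using sidki_letter_hom(2)[OF G] by unfold_locales (simp add: r_def)
  define Y where "Y = l ` X \<union> r ` X"
  have Y: "finite Y" "Y \<subseteq> carrier (sidki G)"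
    using X by (auto simp: Y_def)
  have "l g \<in> generate (sidki G) Y" if "g \<in> carrier G" for g
    using l.generate_img[OF X(2)] X(3) that S.mono_generate[of "l ` X" Y] by (auto simp: Y_def)
  moreover have "r g \<in> generate (sidki G) Y" if "g \<in> carrier G" for g
    using r.generate_img[OF X(2)] X(3) that S.mono_generate[of "r ` X" Y] by (auto simp: Y_def)
  ultimately have letter: "sidki_class G [a] \<in> generate (sidki G) Y" if "[a] \<in> sidki_words G" for a
    using that by (cases a) (auto simp: l_def r_def)
  have "sidki_class G w \<in> generate (sidki G) Y" if "w \<in> sidki_words G" for w
    using that
  proof (induction w)
    case Nil
    show ?case using generate.one[of "sidki G" Y] by (simp add: sidki_one)
  next
    case (Cons a w)
    hence aw: "[a] \<in> sidki_words G" "w \<in> sidki_words G" by (auto simp: sidki_words_def)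
    show ?case
      using generate.eng[OF letter[OF aw(1)] Cons.IH[OF aw(2)]] sidki_mult[OF G aw] by simp
  qed
  hence "generate (sidki G) Y = carrier (sidki G)"
    using S.generate_incl[OF Y(2)] by (auto simp: sidki_carrier)
  with Y show ?thesis
    by (auto simp: finitely_generated_def finite_gen_set_def)
qed

section \<open>Independence of the generating set\<close>

lemma char_equiv_equiv: "equiv (characters H) (char_equiv H)"
proof (rule equivI)
  show "char_equiv H \<subseteq> characters H \<times> characters H" by (auto simp: char_equiv_def)
  show "refl_on (characters H) (char_equiv H)"
    by (auto simp: refl_on_def char_equiv_def intro: exI[of _ 1])
  show "Relation.sym (char_equiv H)"
  proof (rule symI)
    fix \<chi> \<psi> assume "(\<chi>, \<psi>) \<in> char_equiv H"
    then obtain r where "\<chi> \<in> characters H" "\<psi> \<in> characters H" "r > 0"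
      "\<forall>h\<in>carrier H. \<psi> h = r * \<chi> h" by (auto simp: char_equiv_def)
    thus "(\<psi>, \<chi>) \<in> char_equiv H" by (auto simp: char_equiv_def intro!: exI[of _ "1 / r"])
  qed
  show "Relation.trans (char_equiv H)"
  proof (rule transI)
    fix \<chi> \<psi> \<phi> assume "(\<chi>, \<psi>) \<in> char_equiv H" "(\<psi>, \<phi>) \<in> char_equiv H"
    then obtain r s where "\<chi> \<in> characters H" "\<phi> \<in> characters H" "r > 0" "s > 0"
      "\<forall>h\<in>carrier H. \<psi> h = r * \<chi> h" "\<forall>h\<in>carrier H. \<phi> h = s * \<psi> h"
      by (auto simp: char_equiv_def)
    thus "(\<chi>, \<phi>) \<in> char_equiv H" by (auto simp: char_equiv_def intro!: exI[of _ "s * r"])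
  qed
qed

definition level_steps ::
    "('a, 'b) monoid_scheme \<Rightarrow> 'a set \<Rightarrow> ('a \<Rightarrow> real) \<Rightarrow> real \<Rightarrow> ('a \<times> 'a) set" where
  "level_steps H X \<chi> c = {(u, v). u \<in> carrier H \<and> v \<in> carrier H \<and> \<chi> u \<ge> c \<and> \<chi> v \<ge> c \<and>
     (\<exists>x\<in>X. v = u \<otimes>\<^bsub>H\<^esub> x \<or> u = v \<otimes>\<^bsub>H\<^esub> x)}"

lemma connected_cayley_iff:
  assumes "group H" "X \<subseteq> carrier H" "\<chi> \<one>\<^bsub>H\<^esub> = 0"
  shows "Digraph_Component.connected (cayley_graph_char H X \<chi>) \<longleftrightarrow>
    (\<forall>u\<in>nonneg_part H \<chi>. \<forall>v\<in>nonneg_part H \<chi>. (u, v) \<in> (level_steps H X \<chi> 0)\<^sup>*)"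
proof -
  interpret group H by fact
  define \<Gamma> where "\<Gamma> = cayley_graph_char H X \<chi>"
  have v: "verts \<Gamma> = nonneg_part H \<chi>"
    by (simp add: \<Gamma>_def cayley_graph_char_def induce_subgraph_def)
  have p: "parcs (mk_symmetric \<Gamma>) = level_steps H X \<chi> 0"
    using assms(2)
    by (force simp: \<Gamma>_def mk_symmetric_def symcl_def arcs_ends_def arc_to_ends_def cayley_graph_char_def
        cayley_graph_def induce_subgraph_def nonneg_part_def level_steps_def image_iff)
  have r: "(u, w) \<in> rtrancl_on (nonneg_part H \<chi>) (level_steps H X \<chi> 0) \<longleftrightarrow>
      (u, w) \<in> (level_steps H X \<chi> 0)\<^sup>*" if "u \<in> nonneg_part H \<chi>" for u w
  proof
    assume "(u, w) \<in> (level_steps H X \<chi> 0)\<^sup>*"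
    thus "(u, w) \<in> rtrancl_on (nonneg_part H \<chi>) (level_steps H X \<chi> 0)"
    proof induction
      case base
      show ?case using that by (rule rtrancl_on_refl)
    next
      case (step y z)
      have "z \<in> nonneg_part H \<chi>" using step(2) by (auto simp: level_steps_def nonneg_part_def)
      with step show ?case by (auto intro: rtrancl_on.rtrancl_on_into_rtrancl_on)
    qed
  qed (rule rtrancl_on_rtranclI)
  have "\<one>\<^bsub>H\<^esub> \<in> nonneg_part H \<chi>" using assms(3) by (simp add: nonneg_part_def)
  moreover have "verts (with_proj (mk_symmetric \<Gamma>)) = nonneg_part H \<chi>"
    using v by (simp add: mk_symmetric_def)
  moreover have "arcs_ends (with_proj (mk_symmetric \<Gamma>)) = level_steps H X \<chi> 0"
    using p by (simp add: arcs_ends_def arc_to_ends_def)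
  ultimately show ?thesis
    unfolding \<Gamma>_def[symmetric] Digraph_Component.connected_def strongly_connected_def reachable_def
    using r by auto
qed

lemma level_steps_sym: "(u, v) \<in> (level_steps H X \<chi> c)\<^sup>* \<Longrightarrow> (v, u) \<in> (level_steps H X \<chi> c)\<^sup>*"
  by (rule symD[OF sym_rtrancl]) (auto simp: sym_def level_steps_def)

lemma level_steps_mono: "c \<le> d \<Longrightarrow> (level_steps H X \<chi> d)\<^sup>* \<subseteq> (level_steps H X \<chi> c)\<^sup>*"
  by (rule rtrancl_mono) (auto simp: level_steps_def)

locale group_character = group H for H (structure) +
  fixes \<chi> assumes char: "\<chi> \<in> characters H"
begin

lemma char_mult: "x \<in> carrier H \<Longrightarrow> y \<in> carrier H \<Longrightarrow> \<chi> (x \<otimes> y) = \<chi> x + \<chi> y"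
  using char by (auto simp: characters_def hom_def real_add_group_def)

lemma char_one: "\<chi> \<one> = 0"
  using char_mult[of \<one> \<one>] by simp

lemma char_inv: "x \<in> carrier H \<Longrightarrow> \<chi> (inv x) = - \<chi> x"
  using char_mult[of x "inv x"] char_one by simp

lemma level_steps_translate:
  assumes "(u, v) \<in> (level_steps H X \<chi> c)\<^sup>*" "t \<in> carrier H" "X \<subseteq> carrier H"
  shows "(t \<otimes> u, t \<otimes> v) \<in> (level_steps H X \<chi> (c + \<chi> t))\<^sup>*"
  using assms(1)
proof induction
  case (step y z)
  have "(t \<otimes> y, t \<otimes> z) \<in> level_steps H X \<chi> (c + \<chi> t)"
    using step(2) assms(2,3) by (force simp: level_steps_def char_mult m_assoc subset_iff)
  with step show ?case by (rule_tac rtrancl_into_rtrancl)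
qed auto

lemma level_path:
  assumes "X \<subseteq> carrier H" "g \<in> generate H X"
  shows "\<exists>c. (\<one>, g) \<in> (level_steps H X \<chi> c)\<^sup>*"
  using assms(2)
proof induction
  case one
  show ?case by blast
next
  case (incl h)
  hence "(\<one>, h) \<in> level_steps H X \<chi> (min 0 (\<chi> h))"
    using assms(1) by (auto simp: level_steps_def char_one intro!: bexI[of _ h])
  thus ?case by blast
next
  case (inv h)
  hence "(\<one>, inv h) \<in> level_steps H X \<chi> (min 0 (\<chi> (inv h)))"
    using assms(1) by (auto simp: level_steps_def char_one subset_iff intro!: bexI[of _ h])
  thus ?case by blast
next
  case (eng h1 h2)
  then obtain c1 c2 where c: "(\<one>, h1) \<in> (level_steps H X \<chi> c1)\<^sup>*"
    "(\<one>, h2) \<in> (level_steps H X \<chi> c2)\<^sup>*" by blast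
  have h: "h1 \<in> carrier H" "h2 \<in> carrier H"
    using eng generate_in_carrier[OF assms(1)] by auto
  let ?c = "min c1 (c2 + \<chi> h1)"
  have "(h1, h1 \<otimes> h2) \<in> (level_steps H X \<chi> ?c)\<^sup>*"
    using level_steps_translate[OF c(2) h(1) assms(1)] h
      level_steps_mono[of ?c "c2 + \<chi> h1" H X \<chi>] by auto
  moreover have "(\<one>, h1) \<in> (level_steps H X \<chi> ?c)\<^sup>*"
    using c(1) level_steps_mono[of ?c c1 H X \<chi>] by auto
  ultimately show ?case by (blast intro: rtrancl_trans)
qed

lemma level_paths:
  assumes "finite X" "X \<subseteq> carrier H" "Y \<subseteq> carrier H" "generate H Y = carrier H"
  shows "\<exists>c. \<forall>x\<in>X. (\<one>, x) \<in> (level_steps H Y \<chi> c)\<^sup>*"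
  using assms(1,2)
proof induction
  case (insert x X)
  then obtain c where c: "\<forall>x\<in>X. (\<one>, x) \<in> (level_steps H Y \<chi> c)\<^sup>*" by auto
  obtain d where d: "(\<one>, x) \<in> (level_steps H Y \<chi> d)\<^sup>*"
    using level_path[OF assms(3), of x] insert.prems assms(4) by auto
  have "\<forall>y\<in>insert x X. (\<one>, y) \<in> (level_steps H Y \<chi> (min c d))\<^sup>*"
    using c d level_steps_mono[of "min c d" c H Y \<chi>] level_steps_mono[of "min c d" d H Y \<chi>] by auto
  thus ?case by blast
qed auto

lemma positive_letter:
  assumes "Y \<subseteq> carrier H" "generate H Y = carrier H"
  shows "\<exists>t\<in>carrier H. \<chi> t > 0 \<and> (t \<in> Y \<or> inv t \<in> Y)"
proof (rule ccontr)
  assume neg: "\<not> ?thesis"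
  have zero: "\<chi> y = 0" if "y \<in> Y" for y
  proof -
    have "y \<in> carrier H" using that assms by auto
    hence "\<not> \<chi> y > 0" "\<not> \<chi> (inv y) > 0"
      using neg that inv_inv[of y] inv_closed[of y] by metis+
    thus ?thesis
      using char_inv[OF \<open>y \<in> carrier H\<close>] by simp
  qed
  have "\<chi> g = 0" if "g \<in> generate H Y" for g
    using that
  proof induction
    case (eng a b)
    thus ?case using generate_in_carrier[OF assms(1)] by (simp add: char_mult)
  qed (use assms zero char_one char_inv in auto)
  thus False using char assms by (auto simp: characters_def)
qed

lemma connected_transfer:
  assumes X: "finite X" "X \<subseteq> carrier H"
    and Y: "Y \<subseteq> carrier H" "generate H Y = carrier H"
    and conn: "Digraph_Component.connected (cayley_graph_char H X \<chi>)"
  shows "Digraph_Component.connected (cayley_graph_char H Y \<chi>)"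
proof -
  obtain c where c: "\<forall>x\<in>X. (\<one>, x) \<in> (level_steps H Y \<chi> c)\<^sup>*"
    using level_paths[OF X Y] by blast
  have edge: "(u, u \<otimes> x) \<in> (level_steps H Y \<chi> c)\<^sup>*"
    if "u \<in> carrier H" "\<chi> u \<ge> 0" "x \<in> X" for u x
    using level_steps_translate[of \<one> x Y c u] c that Y
      level_steps_mono[of c "c + \<chi> u" H Y \<chi>] by auto
  have lift: "(u, v) \<in> (level_steps H Y \<chi> c)\<^sup>*" if "(u, v) \<in> (level_steps H X \<chi> 0)\<^sup>*" for u v
    using that
  proof induction
    case (step y z)
    have "(y, z) \<in> (level_steps H Y \<chi> c)\<^sup>*"
      using step(2) edge[of y] level_steps_sym[OF edge[of z]] by (auto simp: level_steps_def)
    with step.IH show ?case by (rule rtrancl_trans)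
  qed auto
  obtain t where t: "t \<in> carrier H" "\<chi> t > 0" "t \<in> Y \<or> inv t \<in> Y"
    using positive_letter[OF Y] by blast
  have pow: "\<chi> (t [^] n) = real n * \<chi> t" for n :: nat
    using t by (induction n) (auto simp: char_one char_mult algebra_simps)
  have climb: "(h, h \<otimes> t [^] n) \<in> (level_steps H Y \<chi> 0)\<^sup>*" if h: "h \<in> nonneg_part H \<chi>" for h and n :: nat
  proof (induction n)
    case 0
    show ?case using h by (simp add: nonneg_part_def)
  next
    case (Suc n)
    let ?u = "h \<otimes> t [^] n"
    have hc: "h \<in> carrier H" "\<chi> h \<ge> 0" using h by (auto simp: nonneg_part_def)
    have "?u = (?u \<otimes> t) \<otimes> inv t" using hc t by (simp add: m_assoc)
    moreover have "\<chi> (?u \<otimes> t) \<ge> 0" "\<chi> ?u \<ge> 0" using hc t by (auto simp: char_mult pow)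
    ultimately have "(?u, ?u \<otimes> t) \<in> level_steps H Y \<chi> 0"
      using hc t by (auto simp: level_steps_def)
    with Suc show ?case using hc t by (simp add: m_assoc)
  qed
  obtain n :: nat where "real n * \<chi> t > - c"
    using t(2) reals_Archimedean3 by blast
  define s where "s = t [^] n"
  have s: "s \<in> carrier H" "c + \<chi> s \<ge> 0"
    using t \<open>real n * \<chi> t > - c\<close> by (auto simp: s_def pow)
  have one: "\<one> \<in> nonneg_part H \<chi>" by (simp add: nonneg_part_def char_one)
  have base: "(\<one>, h) \<in> (level_steps H Y \<chi> 0)\<^sup>*" if h: "h \<in> nonneg_part H \<chi>" for h
  proof -
    have hc: "h \<in> carrier H" "\<chi> h \<ge> 0" using h by (auto simp: nonneg_part_def)
    define g where "g = inv s \<otimes> (h \<otimes> s)"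
    have g: "g \<in> nonneg_part H \<chi>" "s \<otimes> g = h \<otimes> s"
      using hc s by (auto simp: g_def nonneg_part_def char_mult char_inv m_assoc[symmetric])
    have "(\<one>, g) \<in> (level_steps H X \<chi> 0)\<^sup>*"
      using conn connected_cayley_iff[where \<chi> = \<chi>, OF is_group X(2) char_one] one g by blast
    from level_steps_translate[OF lift[OF this] s(1) Y(1)]
    have "(s, h \<otimes> s) \<in> (level_steps H Y \<chi> (c + \<chi> s))\<^sup>*" using g s by simp
    hence "(s, h \<otimes> s) \<in> (level_steps H Y \<chi> 0)\<^sup>*"
      using level_steps_mono[OF s(2)] by blast
    moreover have "(\<one>, s) \<in> (level_steps H Y \<chi> 0)\<^sup>*"
      using climb[OF one, of n] s by (simp add: s_def)
    moreover have "(h \<otimes> s, h) \<in> (level_steps H Y \<chi> 0)\<^sup>*"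
      using level_steps_sym[OF climb[OF h, of n]] by (simp add: s_def)
    ultimately show ?thesis by (meson rtrancl_trans)
  qed
  show ?thesis
    unfolding connected_cayley_iff[where \<chi> = \<chi>, OF is_group Y(1) char_one]
    using base level_steps_sym rtrancl_trans by metis
qed

end

theorem Sigma1_independent:
  assumes "group H" "\<chi> \<in> characters H" "finite_gen_set H X"
  shows "char_class H \<chi> \<in> Sigma1 H \<longleftrightarrow> Digraph_Component.connected (cayley_graph_char H X \<chi>)"
proof
  assume "Digraph_Component.connected (cayley_graph_char H X \<chi>)"
  thus "char_class H \<chi> \<in> Sigma1 H" using assms by (auto simp: Sigma1_def)
next
  interpret group_character H \<chi>
    using assms by (simp add: group_character_def group_character_axioms_def)
  assume "char_class H \<chi> \<in> Sigma1 H"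
  then obtain \<psi> Y where \<psi>: "char_class H \<chi> = char_class H \<psi>" "\<psi> \<in> characters H"
    "finite_gen_set H Y" "Digraph_Component.connected (cayley_graph_char H Y \<psi>)"
    by (auto simp: Sigma1_def)
  have "(\<chi>, \<psi>) \<in> char_equiv H"
    using eq_equiv_class_iff[OF char_equiv_equiv assms(2) \<psi>(2)] \<psi>(1) by (simp add: char_class_def)
  then obtain r where "r > 0" "\<forall>h\<in>carrier H. \<psi> h = r * \<chi> h"
    by (auto simp: char_equiv_def)
  hence "nonneg_part H \<psi> = nonneg_part H \<chi>"
    by (auto simp: nonneg_part_def zero_le_mult_iff)
  hence "Digraph_Component.connected (cayley_graph_char H Y \<chi>)"
    using \<psi>(4) by (simp add: cayley_graph_char_def)
  thus "Digraph_Component.connected (cayley_graph_char H X \<chi>)"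
    using connected_transfer \<psi>(3) assms(3) by (auto simp: finite_gen_set_def)
qed

end

theory Submission
  imports Defs
begin

text \<open>
  Write \<open>l g\<close> and \<open>r g\<close> for the images of \<open>g\<close> under the two embeddings of \<open>G\<close> into \<open>X(G)\<close>. The theorem
  follows from a description of the complement of \<open>\<Sigma>\<^sup>1(X(G))\<close>, \<open>not_in_Sigma1_iff\<close>: the class of a character
  \<open>\<chi>\<close> lies in it if and only if \<open>\<chi>\<close> is the pullback of a character whose class is in the complement of \<open>\<Sigma>\<^sup>1(G)\<close>
  along one of the three retractions \<open>X(G) \<rightarrow> G\<close> that kill the second copy, kill the first copy, or
  identify both copies. So the complement for \<open>X(G)\<close> consists of three copies of the one for \<open>G\<close>,
  each in a rationally defined subsphere, and the first of them is its intersection with the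
  subsphere of the characters that vanish on the second copy.

  Pullbacks of the complement lie in the complement since \<open>\<Sigma>\<^sup>1\<close> passes to quotients. For the converse,
  the components of the sets \<open>\<chi> \<ge> c\<close> in the Cayley graph, for all real \<open>c\<close>, form a tree on which the
  group acts. Every \<open>t\<close> with \<open>\<chi> t > 0\<close> has an axis in it, whose stabiliser \<open>axis_stab t\<close> contains the
  centraliser of \<open>t\<close>; elements of positive value in the stabiliser have the same axis
  (\<open>axis_stab_mono\<close>), and the class of \<open>\<chi>\<close> lies in \<open>\<Sigma>\<^sup>1\<close> if and only if the whole group stabilises an axis. If
  the restriction of \<open>\<chi>\<close> to a copy of \<open>G\<close> lies in \<open>\<Sigma>\<^sup>1(G)\<close>, then that copy stabilises the axis of each of its
  elements of positive value. If \<open>\<chi>\<close> agrees on both copies, the axes of \<open>l t\<close> and \<open>r t\<close> coincide because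
  these elements commute. If \<open>\<chi>\<close> differs on the two copies, some \<open>(l x)\<^sup>-\<^sup>1 r x\<close> has non-zero value, and
  the defining relations imply that it commutes with all the commutators \<open>[l g, r h]\<close>
  (\<open>mixed_commute\<close>). Therefore these commutators can be joined to 1 with a uniformly bounded descent,
  and the copies behave as if they commuted: each stabilises the axes of the elements of
  the other one (\<open>j_stabilizes_axis_of_i\<close>).

  Rational semispheres are handled without bases: up to the whole sphere they are the sets
  \<open>\<chi> h \<ge> 0\<close> for a group element \<open>h\<close> (\<open>rational_polyhedron_iff\<close>), and such conditions are easily transported
  along homomorphisms. This requires that a finitely generated torsion-free abelian group has a
  basis (\<open>torsion_free_basis\<close>).
\<close>

section \<open>Stabilisers of axes in Cayley graphs\<close>

lemma level_steps_hom:
  assumes i: "i \<in> hom G H" and "i ` Y \<subseteq> X" and "Y \<subseteq> carrier G"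
    and char: "\<And>g. g \<in> carrier G \<Longrightarrow> \<chi> (i g) = \<psi> g"
    and path: "(u, v) \<in> (level_steps G Y \<psi> c)\<^sup>*"
  shows "(i u, i v) \<in> (level_steps H X \<chi> c)\<^sup>*"
  using path
proof induction
  case (step v w)
  from step(2) obtain y where y: "y \<in> Y" "w = v \<otimes>\<^bsub>G\<^esub> y \<or> v = w \<otimes>\<^bsub>G\<^esub> y"
    and vw: "v \<in> carrier G" "w \<in> carrier G" "\<psi> v \<ge> c" "\<psi> w \<ge> c"
    by (auto simp: level_steps_def)
  have "y \<in> carrier G" "i y \<in> X" using y assms(2,3) by auto
  hence "(i v, i w) \<in> level_steps H X \<chi> c"
    using y(2) vw by (auto simp: level_steps_def char hom_in_carrier[OF i] hom_mult[OF i]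
        intro!: bexI[of _ "i y"])
  with step.IH show ?case by (rule rtrancl_into_rtrancl)
qed auto

text \<open>
  A group with a character \<open>\<chi>\<close> and a finite generating set. Below, \<open>path c u v\<close> says that \<open>u\<close> and \<open>v\<close>
  are joined in the part of the Cayley graph where \<open>\<chi> \<ge> c\<close>; translation by \<open>t\<close> raises the level by \<open>\<chi> t\<close>.
\<close>

locale cayley_character = group_character +
  fixes X assumes gen_set: "finite_gen_set H X"
begin

abbreviation path :: "real \<Rightarrow> 'a \<Rightarrow> 'a \<Rightarrow> bool" where
  "path c u v \<equiv> (u, v) \<in> (level_steps H X \<chi> c)\<^sup>*"

lemma X_carrier: "X \<subseteq> carrier H" and generate_X: "generate H X = carrier H"
  using gen_set by (auto simp: finite_gen_set_def)

lemma path_mono: "path d u v \<Longrightarrow> c \<le> d \<Longrightarrow> path c u v"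
  using level_steps_mono by blast

lemma path_sym: "path c u v \<Longrightarrow> path c v u"
  by (rule level_steps_sym)

lemma path_translate: "path c u v \<Longrightarrow> t \<in> carrier H \<Longrightarrow> d \<le> c + \<chi> t \<Longrightarrow> path d (t \<otimes> u) (t \<otimes> v)"
  using level_steps_translate[OF _ _ X_carrier] path_mono by blast

lemma path_from_one: "h \<in> carrier H \<Longrightarrow> \<exists>c. path c \<one> h"
  using level_path[OF X_carrier] generate_X by simp

lemma char_pow: "t \<in> carrier H \<Longrightarrow> \<chi> (t [^] n) = real n * \<chi> t" for n :: nat
  by (induction n) (auto simp: char_one char_mult algebra_simps)

lemma char_pow_large:
  assumes "t \<in> carrier H" "\<chi> t > 0"
  shows "\<exists>N. \<forall>n\<ge>N. c \<le> \<chi> (t [^] (n::nat))"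
proof -
  obtain N :: nat where N: "real N * \<chi> t > c"
    using assms(2) reals_Archimedean3 by blast
  have "c \<le> real n * \<chi> t" if "n \<ge> N" for n
  proof -
    have "real N * \<chi> t \<le> real n * \<chi> t" using that assms(2) by (simp add: mult_right_mono)
    thus ?thesis using N by linarith
  qed
  thus ?thesis using char_pow[OF assms(1)] by auto
qed

lemma path_ray_bounded:
  assumes t: "t \<in> carrier H" "\<chi> t > 0"
  shows "\<exists>c. \<forall>n::nat. path c \<one> (t [^] n)"
proof -
  obtain c where c: "path c \<one> t" using path_from_one t by blast
  have "path c \<one> (t [^] n)" for n :: nat
  proof (induction n)
    case (Suc n)
    have "path c (t [^] n \<otimes> \<one>) (t [^] n \<otimes> t)"
      by (rule path_translate[OF c]) (use t in \<open>auto simp: char_pow\<close>)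
    thus ?case using Suc t by (auto intro: rtrancl_trans)
  qed auto
  thus ?thesis by blast
qed

text \<open>
  A path from 1 to \<open>h\<close>, translated far up along the ray of \<open>t\<close>, stays above any prescribed level.
\<close>

lemma path_right_mult:
  assumes t: "t \<in> carrier H" "\<chi> t > 0" and h: "h \<in> carrier H"
  shows "\<exists>N. \<forall>n\<ge>N. path c (t [^] (n::nat)) (t [^] n \<otimes> h)"
proof -
  obtain d where d: "path d \<one> h" using path_from_one h by blast
  obtain N where N: "\<forall>n\<ge>N. c - d \<le> \<chi> (t [^] (n::nat))"
    using char_pow_large[OF t] by blast
  have "path c (t [^] n \<otimes> \<one>) (t [^] n \<otimes> h)" if "n \<ge> N" for n
    by (rule path_translate[OF d]) (use N that t in \<open>auto simp: algebra_simps\<close>)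
  thus ?thesis using t by auto
qed

text \<open>
  For \<open>\<chi> t > 0\<close> the upward ray \<open>1, t, t\<^sup>2, \<dots>\<close> selects one component of \<open>\<chi> \<ge> c\<close> for every level \<open>c\<close>. These
  components form a line in the tree of all components of all \<open>\<chi> \<ge> c\<close>, the axis of \<open>t\<close>. The set
  \<open>axis_stab t\<close> is its stabiliser: the elements \<open>h\<close> for which the rays of \<open>t\<close> and its translate by
  \<open>h\<close> end in the same component above every level.
\<close>

definition axis_stab :: "'a \<Rightarrow> 'a set" where
  "axis_stab t = {h \<in> carrier H. \<forall>c. \<exists>N. \<forall>n\<ge>N. path c (t [^] (n::nat)) (h \<otimes> t [^] n)}"

lemma axis_stab_carrier: "h \<in> axis_stab t \<Longrightarrow> h \<in> carrier H"
  by (simp add: axis_stab_def)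

lemma axis_stabD:
  assumes "h \<in> axis_stab t"
  obtains N where "\<And>n::nat. n \<ge> N \<Longrightarrow> path c (t [^] n) (h \<otimes> t [^] n)"
  using assms by (auto simp: axis_stab_def)

lemma axis_stab_subgroup:
  assumes t: "t \<in> carrier H"
  shows "subgroup (axis_stab t) H"
proof (rule subgroupI)
  show "axis_stab t \<subseteq> carrier H" by (auto simp: axis_stab_def)
  have "\<one> \<in> axis_stab t" using t by (auto simp: axis_stab_def)
  thus "axis_stab t \<noteq> {}" by blast
next
  fix h assume h: "h \<in> axis_stab t"
  hence hc: "h \<in> carrier H" by (rule axis_stab_carrier)
  have "\<exists>N. \<forall>n\<ge>N. path c (t [^] (n::nat)) (inv h \<otimes> t [^] n)" for c
  proof -
    obtain N where N: "\<And>n::nat. n \<ge> N \<Longrightarrow> path (c + \<chi> h) (t [^] n) (h \<otimes> t [^] n)"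
      using axis_stabD[OF h] by blast
    have "path c (inv h \<otimes> t [^] n) (inv h \<otimes> (h \<otimes> t [^] n))" if "n \<ge> N" for n
      by (rule path_translate[OF N[OF that]]) (use hc char_inv in auto)
    hence "path c (t [^] n) (inv h \<otimes> t [^] n)" if "n \<ge> N" for n
      using that hc t path_sym by (simp add: m_assoc[symmetric])
    thus ?thesis by blast
  qed
  thus "inv h \<in> axis_stab t" using hc by (simp add: axis_stab_def)
next
  fix h k assume h: "h \<in> axis_stab t" and k: "k \<in> axis_stab t"
  hence hc: "h \<in> carrier H" "k \<in> carrier H" using axis_stab_carrier by auto
  have "\<exists>N. \<forall>n\<ge>N. path c (t [^] (n::nat)) (h \<otimes> k \<otimes> t [^] n)" for c
  proof -
    obtain N where N: "\<And>n::nat. n \<ge> N \<Longrightarrow> path c (t [^] n) (h \<otimes> t [^] n)"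
      using axis_stabD[OF h] by blast
    obtain M where M: "\<And>n::nat. n \<ge> M \<Longrightarrow> path (c - \<chi> h) (t [^] n) (k \<otimes> t [^] n)"
      using axis_stabD[OF k] by blast
    have "path c (t [^] n) (h \<otimes> k \<otimes> t [^] n)" if "n \<ge> max N M" for n
    proof -
      have "path c (h \<otimes> t [^] n) (h \<otimes> (k \<otimes> t [^] n))"
        by (rule path_translate[OF M]) (use that hc in auto)
      thus ?thesis using N[of n] that hc t by (auto simp: m_assoc intro: rtrancl_trans)
    qed
    thus ?thesis by blast
  qed
  thus "h \<otimes> k \<in> axis_stab t" using hc by (simp add: axis_stab_def)
qed

lemma centralizer_axis_stab:
  assumes t: "t \<in> carrier H" "\<chi> t > 0" and h: "h \<in> carrier H" "h \<otimes> t = t \<otimes> h"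
  shows "h \<in> axis_stab t"
proof -
  have "h \<otimes> t [^] n = t [^] n \<otimes> h" for n :: nat
  proof (induction n)
    case (Suc n)
    have "h \<otimes> t [^] Suc n = (h \<otimes> t [^] n) \<otimes> t" using t h by (simp add: m_assoc)
    also have "\<dots> = t [^] n \<otimes> (h \<otimes> t)" using Suc t h by (simp add: m_assoc)
    also have "\<dots> = t [^] Suc n \<otimes> h" using h t by (simp add: m_assoc)
    finally show ?case .
  qed (use h in simp)
  thus ?thesis using path_right_mult[OF t h(1)] h by (simp add: axis_stab_def)
qed

text \<open>
  An element of positive value that stabilises the axis of \<open>t\<close> has that same axis. Only one
  inclusion is stated; the other one follows by exchanging \<open>s\<close> and \<open>t\<close>.
\<close>

lemma axis_stab_mono:
  assumes t: "t \<in> carrier H" "\<chi> t > 0" and s: "s \<in> axis_stab t" "\<chi> s > 0"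
  shows "axis_stab t \<subseteq> axis_stab s"
proof
  fix h assume h: "h \<in> axis_stab t"
  have hc: "h \<in> carrier H" "s \<in> carrier H" using axis_stab_carrier h s by auto
  obtain K where K: "\<And>n::nat. path K \<one> (t [^] n)" using path_ray_bounded[OF t] by blast
  \<comment> \<open>The rays of \<open>s\<close> and \<open>t\<close> eventually lie in the same component above any level.\<close>
  have conv: "\<exists>N. \<forall>n\<ge>N. path c (s [^] m) (t [^] (n::nat))" if m: "c - K \<le> \<chi> (s [^] m)" for c and m :: nat
  proof -
    have "s [^] m \<in> axis_stab t"
    proof -
      interpret S: subgroup "axis_stab t" H using axis_stab_subgroup t by blast
      show ?thesis by (induction m) (use s in auto)
    qed
    then obtain N where N: "\<And>n::nat. n \<ge> N \<Longrightarrow> path c (t [^] n) (s [^] m \<otimes> t [^] n)"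
      using axis_stabD by blast
    have "path c (s [^] m \<otimes> \<one>) (s [^] m \<otimes> t [^] n)" for n :: nat
      by (rule path_translate[OF K]) (use hc m in auto)
    hence "path c (s [^] m) (s [^] m \<otimes> t [^] n)" for n :: nat using hc by simp
    hence "path c (s [^] m) (t [^] n)" if "n \<ge> N" for n
      using path_sym[OF N[OF that]] by (rule rtrancl_trans)
    thus ?thesis by blast
  qed
  have "\<exists>M. \<forall>m\<ge>M. path c (s [^] (m::nat)) (h \<otimes> s [^] m)" for c
  proof -
    define d where "d = max c (c - \<chi> h)"
    obtain M where M: "\<forall>m\<ge>M. d - K \<le> \<chi> (s [^] (m::nat))"
      using char_pow_large hc s by blast
    have "path c (s [^] m) (h \<otimes> s [^] m)" if mM: "m \<ge> M" for m
    proof -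
      obtain N1 where N1: "\<forall>n\<ge>N1. path d (s [^] m) (t [^] (n::nat))"
        using conv[of d m] M mM by auto
      obtain N2 where N2: "\<And>n::nat. n \<ge> N2 \<Longrightarrow> path c (t [^] n) (h \<otimes> t [^] n)"
        using axis_stabD[OF h] by blast
      define n where "n = max N1 N2"
      have st: "path d (s [^] m) (t [^] n)" using N1 by (simp add: n_def)
      have "path c (s [^] m) (t [^] n)" by (rule path_mono[OF st]) (simp add: d_def)
      moreover have "path c (t [^] n) (h \<otimes> t [^] n)" using N2 by (simp add: n_def)
      moreover have "path c (h \<otimes> t [^] n) (h \<otimes> s [^] m)"
        by (rule path_translate[OF path_sym[OF st]]) (auto simp: d_def hc)
      ultimately show ?thesis by (meson rtrancl_trans)
    qed
    thus ?thesis by blast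
  qed
  thus "h \<in> axis_stab s" using hc by (simp add: axis_stab_def)
qed

lemma in_Sigma1_iff_connected:
  "char_class H \<chi> \<in> Sigma1 H \<longleftrightarrow>
    (\<forall>u\<in>nonneg_part H \<chi>. \<forall>v\<in>nonneg_part H \<chi>. path 0 u v)"
  using Sigma1_independent[OF is_group char gen_set]
    connected_cayley_iff[where \<chi> = \<chi>, OF is_group X_carrier char_one] by simp

text \<open>
  Together with \<open>axis_stab_if_in_Sigma1\<close>: \<open>[\<chi>]\<close> lies in \<open>\<Sigma>\<^sup>1\<close> if and only if the whole group stabilises
  one axis, equivalently every axis.
\<close>

lemma in_Sigma1_if_axis_stab:
  assumes t: "t \<in> carrier H" "\<chi> t > 0" and stab: "axis_stab t = carrier H"
  shows "char_class H \<chi> \<in> Sigma1 H"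
proof -
  obtain p where p: "p \<in> carrier H" "\<chi> p > 0" "p \<in> X \<or> inv p \<in> X"
    using positive_letter[OF X_carrier generate_X] by blast
  have p_stab: "h \<in> axis_stab p" if "h \<in> carrier H" for h
    using axis_stab_mono[OF t, of p] p stab that by auto
  \<comment> \<open>Since \<open>p\<close> is a generator or the inverse of one, its powers can be followed without descending.\<close>
  have climb: "path 0 h (h \<otimes> p [^] n)" if h: "h \<in> carrier H" "\<chi> h \<ge> 0" for h and n :: nat
  proof (induction n)
    case (Suc n)
    let ?u = "h \<otimes> p [^] n"
    have "?u = (?u \<otimes> p) \<otimes> inv p" using h p by (simp add: m_assoc)
    moreover have "\<chi> (?u \<otimes> p) \<ge> 0" "\<chi> ?u \<ge> 0" using h p by (auto simp: char_mult char_pow)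
    ultimately have "(?u, ?u \<otimes> p) \<in> level_steps H X \<chi> 0"
      using h p by (auto simp: level_steps_def)
    with Suc show ?case using h p by (simp add: m_assoc)
  qed (use h in simp)
  have base: "path 0 \<one> h" if h: "h \<in> nonneg_part H \<chi>" for h
  proof -
    have hc: "h \<in> carrier H" "\<chi> h \<ge> 0" using h by (auto simp: nonneg_part_def)
    obtain N where "\<And>n::nat. n \<ge> N \<Longrightarrow> path 0 (p [^] n) (h \<otimes> p [^] n)"
      using axis_stabD[OF p_stab[OF hc(1)]] by blast
    hence "path 0 (p [^] N) (h \<otimes> p [^] N)" by simp
    moreover have "path 0 \<one> (p [^] N)" using climb[of \<one> N] p by (simp add: char_one)
    moreover have "path 0 (h \<otimes> p [^] N) h" using path_sym climb hc by blast
    ultimately show ?thesis by (meson rtrancl_trans)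
  qed
  show ?thesis unfolding in_Sigma1_iff_connected
    using base path_sym by (meson rtrancl_trans)
qed

lemma axis_stab_if_in_Sigma1:
  assumes t: "t \<in> carrier H" "\<chi> t > 0" and conn: "char_class H \<chi> \<in> Sigma1 H"
  shows "axis_stab t = carrier H"
proof (intro equalityI subsetI)
  fix h assume h: "h \<in> carrier H"
  have "\<exists>N. \<forall>n\<ge>N. path c (t [^] (n::nat)) (h \<otimes> t [^] n)" for c
  proof -
    obtain m where "\<forall>n\<ge>m. c \<le> \<chi> (t [^] (n::nat))" using char_pow_large[OF t] by blast
    hence m: "c \<le> \<chi> (t [^] m)" by simp
    define s where "s = t [^] m"
    have s: "s \<in> carrier H" using t by (simp add: s_def)
    obtain N where N: "\<forall>n\<ge>N. \<chi> s + \<bar>\<chi> h\<bar> \<le> \<chi> (t [^] (n::nat))"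
      using char_pow_large[OF t] by blast
    have "path c (t [^] n) (h \<otimes> t [^] n)" if "n \<ge> N" for n
    proof -
      have "\<chi> s + \<bar>\<chi> h\<bar> \<le> \<chi> (t [^] n)" using N that by simp
      hence "inv s \<otimes> t [^] n \<in> nonneg_part H \<chi>" "inv s \<otimes> (h \<otimes> t [^] n) \<in> nonneg_part H \<chi>"
        using s t h by (auto simp: nonneg_part_def char_mult char_inv)
      hence "path 0 (inv s \<otimes> t [^] n) (inv s \<otimes> (h \<otimes> t [^] n))"
        using conn in_Sigma1_iff_connected by blast
      hence "path c (s \<otimes> (inv s \<otimes> t [^] n)) (s \<otimes> (inv s \<otimes> (h \<otimes> t [^] n)))"
        by (rule path_translate) (use s m in \<open>auto simp: s_def\<close>)
      thus ?thesis using s t h by (simp add: m_assoc[symmetric])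
    qed
    thus ?thesis by blast
  qed
  thus "h \<in> axis_stab t" using h by (simp add: axis_stab_def)
qed (rule axis_stab_carrier)

text \<open>
  The elements of level 0 that commute with one fixed \<open>l\<close> of positive value are reached from 1 with
  a bound on the descent that does not depend on the element: follow the ray of \<open>l\<close> upwards and
  come back along its translate.
\<close>

lemma centralizer_uniform_path:
  assumes l: "l \<in> carrier H" "\<chi> l > 0"
  shows "\<exists>c. \<forall>d\<in>carrier H. d \<otimes> l = l \<otimes> d \<longrightarrow> \<chi> d = 0 \<longrightarrow> path c \<one> d"
proof -
  obtain K where K: "\<And>n::nat. path K \<one> (l [^] n)" using path_ray_bounded[OF l] by blast
  have "path K \<one> d" if d: "d \<in> carrier H" "d \<otimes> l = l \<otimes> d" "\<chi> d = 0" for d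
  proof -
    obtain N where "\<And>n::nat. n \<ge> N \<Longrightarrow> path K (l [^] n) (d \<otimes> l [^] n)"
      using axis_stabD[OF centralizer_axis_stab[OF l d(1,2)]] by blast
    hence n: "path K (l [^] N) (d \<otimes> l [^] N)" by simp
    have "path K (d \<otimes> \<one>) (d \<otimes> l [^] N)"
      by (rule path_translate[OF K]) (use d in auto)
    hence "path K (d \<otimes> l [^] N) d" using path_sym d by simp
    thus ?thesis using K n by (meson rtrancl_trans)
  qed
  thus ?thesis by blast
qed

end

section \<open>Characters of quotients\<close>

lemma pullback_character:
  assumes "group G" "i \<in> hom G H" "\<chi> \<in> characters H" "\<exists>g\<in>carrier G. \<chi> (i g) \<noteq> 0"
  shows "restrict (\<chi> \<circ> i) (carrier G) \<in> characters G"
proof -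
  interpret group G by fact
  have "restrict (\<chi> \<circ> i) (carrier G) \<in> hom G real_add_group"
    using assms(2,3) by (auto simp: characters_def hom_def real_add_group_def Pi_iff)
  thus ?thesis using assms(4) by (auto simp: characters_def)
qed

text \<open>The invariant passes to quotients: the quotient map carries paths to paths of the same level.\<close>

lemma Sigma1_quotient:
  assumes "group G" "group H" and p: "p \<in> hom H G" "p ` carrier H = carrier G"
    and "finite_gen_set H X" "\<chi> \<in> characters H" "\<psi> \<in> characters G"
    and char: "\<And>h. h \<in> carrier H \<Longrightarrow> \<psi> (p h) = \<chi> h"
    and sigma: "char_class H \<chi> \<in> Sigma1 H"
  shows "char_class G \<psi> \<in> Sigma1 G"
proof -
  interpret H: cayley_character H \<chi> X
    using assms by (simp add: cayley_character_def group_character_def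
        cayley_character_axioms_def group_character_axioms_def)
  interpret p: group_hom H G p
    using assms by (simp add: group_hom_def group_hom_axioms_def)
  have "generate G (p ` X) = carrier G"
    using p.generate_img[OF H.X_carrier] H.generate_X p(2) by simp
  hence "finite_gen_set G (p ` X)"
    using assms(5) H.X_carrier by (auto simp: finite_gen_set_def)
  then interpret G: cayley_character G \<psi> "p ` X"
    using assms by (simp add: cayley_character_def group_character_def
        cayley_character_axioms_def group_character_axioms_def)
  show ?thesis unfolding G.in_Sigma1_iff_connected
  proof (intro ballI)
    fix u v assume "u \<in> nonneg_part G \<psi>" "v \<in> nonneg_part G \<psi>"
    moreover have "\<exists>h\<in>nonneg_part H \<chi>. g = p h" if "g \<in> nonneg_part G \<psi>" for g
    proof -
      have "g \<in> p ` carrier H" "\<psi> g \<ge> 0" using that p(2) by (auto simp: nonneg_part_def)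
      thus ?thesis using char by (auto simp: nonneg_part_def)
    qed
    ultimately obtain u' v' where "u' \<in> nonneg_part H \<chi>" "v' \<in> nonneg_part H \<chi>" "u = p u'" "v = p v'"
      by blast
    moreover from this have "H.path 0 u' v'"
      using sigma[unfolded H.in_Sigma1_iff_connected] by blast
    ultimately show "G.path 0 u v"
      using level_steps_hom[OF p(1) _ H.X_carrier, of "p ` X" \<psi> \<chi> u' v' 0] char by simp
  qed
qed

section \<open>Weakly commuting homomorphisms\<close>

lemma (in group) cancel_left:
  "x \<in> carrier G \<Longrightarrow> y \<in> carrier G \<Longrightarrow> x \<otimes> (inv x \<otimes> y) = y"
  "x \<in> carrier G \<Longrightarrow> y \<in> carrier G \<Longrightarrow> inv x \<otimes> (x \<otimes> y) = y"
  by (simp_all add: m_assoc[symmetric])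

text \<open>
  If \<open>a\<close>, \<open>b\<close> and \<open>a b\<close> commute with \<open>a'\<close>, \<open>b'\<close> and \<open>a' b'\<close> respectively, then the commutators of
  \<open>a'\<close> with \<open>b\<close> and of \<open>a\<close> with \<open>b'\<close> (with the first entries inverted) agree.
\<close>

lemma (in group) commutator_swap:
  assumes "a \<in> carrier G" "b \<in> carrier G" "a' \<in> carrier G" "b' \<in> carrier G"
    and "a \<otimes> a' = a' \<otimes> a" "b \<otimes> b' = b' \<otimes> b"
    and ab: "(a \<otimes> b) \<otimes> (a' \<otimes> b') = (a' \<otimes> b') \<otimes> (a \<otimes> b)"
  shows "inv a' \<otimes> b \<otimes> a' \<otimes> inv b = inv a \<otimes> b' \<otimes> a \<otimes> inv b'" (is "?l = ?r")
proof -
  have "(a' \<otimes> a) \<otimes> (?l \<otimes> (b \<otimes> b')) = (a \<otimes> a') \<otimes> (?l \<otimes> (b \<otimes> b'))"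
    using assms(5) by simp
  also have "\<dots> = (a \<otimes> b) \<otimes> (a' \<otimes> b')"
    using assms(1-4) by (simp add: m_assoc cancel_left)
  also have "\<dots> = (a' \<otimes> a) \<otimes> (?r \<otimes> (b' \<otimes> b))"
    unfolding ab using assms(1-4) by (simp add: m_assoc cancel_left)
  finally have "?l \<otimes> (b \<otimes> b') = ?r \<otimes> (b \<otimes> b')"
    using assms(1-4,6) by simp
  thus ?thesis using assms(1-4) by simp
qed

text \<open>
  Two homomorphisms from \<open>G\<close> whose images generate \<open>H\<close> and satisfy \<open>[i g, j g] = 1\<close>. The situation is
  symmetric in \<open>i\<close> and \<open>j\<close>, see \<open>swapped\<close>, and \<open>X(G)\<close> with its two copies of \<open>G\<close> is an instance.
\<close>

locale weakly_commuting_homs = G: group G + H: group H for G and H (structure) +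
  fixes i j Y
  assumes i: "i \<in> hom G H" and j: "j \<in> hom G H"
    and commute: "\<And>g. g \<in> carrier G \<Longrightarrow> i g \<otimes> j g = j g \<otimes> i g"
    and gen_G: "finite_gen_set G Y"
    and gen_H: "finite_gen_set H (i ` Y \<union> j ` Y)"
begin

sublocale I: group_hom G H i by unfold_locales (rule i)
sublocale J: group_hom G H j by unfold_locales (rule j)

lemma swapped: "weakly_commuting_homs G H j i Y"
  using i j commute gen_G gen_H by unfold_locales (auto simp: Un_commute)

text \<open>The commutator of \<open>i g\<close> with \<open>j h\<close>.\<close>

definition mixed where
  "mixed g h = i g \<otimes> j h \<otimes> inv (i g) \<otimes> inv (j h)"

lemma mixed_closed: "g \<in> carrier G \<Longrightarrow> h \<in> carrier G \<Longrightarrow> mixed g h \<in> carrier H"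
  by (simp add: mixed_def)

lemma mixed_swap:
  assumes "g \<in> carrier G" "h \<in> carrier G"
  shows "mixed g h = j g \<otimes> i h \<otimes> inv (j g) \<otimes> inv (i h)"
proof -
  let ?k = "inv\<^bsub>G\<^esub> g"
  have k: "?k \<in> carrier G" using assms by simp
  have "(i ?k \<otimes> i h) \<otimes> (j ?k \<otimes> j h) = (j ?k \<otimes> j h) \<otimes> (i ?k \<otimes> i h)"
    using commute[of "?k \<otimes>\<^bsub>G\<^esub> h"] k assms by (simp only: I.hom_mult J.hom_mult G.m_closed)
  from H.commutator_swap[OF _ _ _ _ commute[OF k] commute[OF assms(2)] this]
  have "inv (j ?k) \<otimes> i h \<otimes> j ?k \<otimes> inv (i h) = inv (i ?k) \<otimes> j h \<otimes> i ?k \<otimes> inv (j h)"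
    using k assms by (simp only: I.hom_closed J.hom_closed)
  thus ?thesis using assms by (simp add: mixed_def)
qed

lemma mixed_mult:
  assumes "x \<in> carrier G" "g \<in> carrier G" "h \<in> carrier G"
  shows "i x \<otimes> mixed g h = mixed (x \<otimes>\<^bsub>G\<^esub> g) h \<otimes> inv (mixed x h) \<otimes> i x"
  using assms by (simp add: mixed_def H.m_assoc H.inv_mult_group H.cancel_left)

lemma mixed_mult':
  assumes "x \<in> carrier G" "g \<in> carrier G" "h \<in> carrier G"
  shows "j x \<otimes> mixed g h = mixed (x \<otimes>\<^bsub>G\<^esub> g) h \<otimes> inv (mixed x h) \<otimes> j x"
  using assms by (simp add: mixed_swap H.m_assoc H.inv_mult_group H.cancel_left)

text \<open>
  The commutators \<open>[i g, j h]\<close> commute with the elements \<open>(i x)\<^sup>-\<^sup>1 j x\<close>: conjugation by \<open>i x\<close> and by \<open>j x\<close>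
  have the same effect on them, by the identity \<open>x [g, h] x\<^sup>-\<^sup>1 = [x g, h] [x, h]\<^sup>-\<^sup>1\<close> and \<open>mixed_swap\<close>.
\<close>

lemma mixed_commute:
  assumes "x \<in> carrier G" "g \<in> carrier G" "h \<in> carrier G"
  shows "mixed g h \<otimes> (inv (i x) \<otimes> j x) = (inv (i x) \<otimes> j x) \<otimes> mixed g h"
proof -
  let ?m = "mixed (x \<otimes>\<^bsub>G\<^esub> g) h \<otimes> inv (mixed x h)"
  have c: "?m \<in> carrier H" "mixed g h \<in> carrier H" using assms by (simp_all add: mixed_closed)
  have "inv (i x) \<otimes> ?m = inv (i x) \<otimes> (i x \<otimes> mixed g h) \<otimes> inv (i x)"
    unfolding mixed_mult[OF assms] using assms c by (simp add: H.m_assoc)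
  also have "\<dots> = mixed g h \<otimes> inv (i x)"
    using assms c by (simp add: H.cancel_left)
  finally have "mixed g h \<otimes> inv (i x) = inv (i x) \<otimes> ?m" by simp
  hence "mixed g h \<otimes> (inv (i x) \<otimes> j x) = inv (i x) \<otimes> (?m \<otimes> j x)"
    using assms c by (simp add: H.m_assoc[symmetric])
  thus ?thesis using mixed_mult'[OF assms] assms c by (simp add: H.m_assoc)
qed

end

locale weakly_commuting_character = weakly_commuting_homs + 
  fixes \<chi> assumes char': "\<chi> \<in> characters H"
begin

sublocale cayley_character H \<chi> "i ` Y \<union> j ` Y"
  by unfold_locales (use char' gen_H in auto)

lemma swapped_character: "weakly_commuting_character G H j i Y \<chi>"
  using swapped char by (simp add: weakly_commuting_character_def weakly_commuting_character_axioms_def)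

lemma in_Sigma1_if_stab:
  assumes t: "t \<in> carrier H" "\<chi> t > 0"
    and i_stab: "\<And>g. g \<in> carrier G \<Longrightarrow> i g \<in> axis_stab t"
    and j_stab: "\<And>g. g \<in> carrier G \<Longrightarrow> j g \<in> axis_stab t"
  shows "char_class H \<chi> \<in> Sigma1 H"
proof (rule in_Sigma1_if_axis_stab[OF t])
  have "i ` Y \<union> j ` Y \<subseteq> axis_stab t"
    using gen_G i_stab j_stab by (auto simp: finite_gen_set_def)
  hence "generate H (i ` Y \<union> j ` Y) \<subseteq> axis_stab t"
    using H.generate_subgroup_incl axis_stab_subgroup t by blast
  thus "axis_stab t = carrier H" using generate_X axis_stab_carrier by auto
qed

lemma positive_value:
  assumes "g \<in> carrier G" "f \<in> hom G H" "\<chi> (f g) \<noteq> 0"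
  obtains t where "t \<in> carrier G" "\<chi> (f t) > 0"
proof (cases "\<chi> (f g) > 0")
  case False
  interpret f: group_hom G H f using assms(2) by unfold_locales
  have "\<chi> (f (inv\<^bsub>G\<^esub> g)) = - \<chi> (f g)" using assms(1) by (simp add: char_inv)
  thus ?thesis using that[of "inv\<^bsub>G\<^esub> g"] False assms by simp
qed (use that assms in blast)

lemma char_mixed: "g \<in> carrier G \<Longrightarrow> h \<in> carrier G \<Longrightarrow> \<chi> (mixed g h) = 0"
  by (simp add: mixed_def char_mult char_inv)

text \<open>
  If \<open>\<chi>\<close> differs on the two copies, some \<open>(i x)\<^sup>-\<^sup>1 j x\<close> has non-zero value, and all mixed commutators
  commute with it.
\<close>

lemma mixed_uniform_path:
  assumes x: "x \<in> carrier G" "\<chi> (i x) \<noteq> \<chi> (j x)"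
  shows "\<exists>c. \<forall>g\<in>carrier G. \<forall>h\<in>carrier G. path c \<one> (mixed g h)"
proof -
  define l where "l = inv (i x) \<otimes> j x"
  have l: "l \<in> carrier H" "\<chi> l \<noteq> 0" using x by (auto simp: l_def char_mult char_inv)
  have comm: "mixed g h \<otimes> l = l \<otimes> mixed g h" if "g \<in> carrier G" "h \<in> carrier G" for g h
    using mixed_commute that x by (simp add: l_def)
  have comm': "mixed g h \<otimes> inv l = inv l \<otimes> mixed g h" if "g \<in> carrier G" "h \<in> carrier G" for g h
  proof -
    have "inv l \<otimes> (mixed g h \<otimes> l) \<otimes> inv l = inv l \<otimes> (l \<otimes> mixed g h) \<otimes> inv l"
      using comm[OF that] by simp
    thus ?thesis using mixed_closed[OF that] l(1) by (simp add: H.m_assoc H.cancel_left)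
  qed
  obtain p where p: "p \<in> carrier H" "\<chi> p > 0"
    and "\<And>g h. g \<in> carrier G \<Longrightarrow> h \<in> carrier G \<Longrightarrow> mixed g h \<otimes> p = p \<otimes> mixed g h"
  proof (cases "\<chi> l > 0")
    case True
    thus ?thesis using that[OF l(1)] comm by simp
  next
    case False
    hence "\<chi> (inv l) > 0" using l by (simp add: char_inv)
    thus ?thesis using that[of "inv l"] l comm' by simp
  qed
  moreover obtain c where "\<forall>d\<in>carrier H. d \<otimes> p = p \<otimes> d \<longrightarrow> \<chi> d = 0 \<longrightarrow> path c \<one> d"
    using centralizer_uniform_path[OF p] by blast
  ultimately have "\<forall>g\<in>carrier G. \<forall>h\<in>carrier G. path c \<one> (mixed g h)"
    using mixed_closed char_mixed by simp
  thus ?thesis ..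
qed

text \<open>
  Modulo mixed commutators, \<open>j y\<close> commutes with \<open>i t\<close>, and mixed commutators cost a bounded descent only.
\<close>

lemma j_stabilizes_axis_of_i:
  assumes x: "x \<in> carrier G" "\<chi> (i x) \<noteq> \<chi> (j x)"
    and t: "t \<in> carrier G" "\<chi> (i t) > 0" and y: "y \<in> carrier G"
  shows "j y \<in> axis_stab (i t)"
proof -
  obtain K where K: "\<And>g h. g \<in> carrier G \<Longrightarrow> h \<in> carrier G \<Longrightarrow> path K \<one> (mixed g h)"
    using mixed_uniform_path[OF x] by blast
  have it: "i t \<in> carrier H" and jy: "j y \<in> carrier H" using t y by auto
  have "\<exists>N. \<forall>n\<ge>N. path c (i t [^] (n::nat)) (j y \<otimes> i t [^] n)" for c
  proof -
    obtain N where N: "\<forall>n\<ge>N. path c (i t [^] (n::nat)) (i t [^] n \<otimes> j y)"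
      using path_right_mult[OF it t(2) jy] by blast
    obtain M where M: "\<forall>n\<ge>M. c - K - \<chi> (j y) \<le> \<chi> (i t [^] (n::nat))"
      using char_pow_large[OF it t(2)] by blast
    have "path c (i t [^] n) (j y \<otimes> i t [^] n)" if n: "n \<ge> max N M" for n
    proof -
      let ?s = "t [^]\<^bsub>G\<^esub> n"
      let ?d = "mixed (inv\<^bsub>G\<^esub> y) (inv\<^bsub>G\<^esub> ?s)"
      have s: "?s \<in> carrier G" "i ?s = i t [^] n" using t by (auto simp: I.hom_nat_pow)
      have "path c ((i ?s \<otimes> j y) \<otimes> \<one>) ((i ?s \<otimes> j y) \<otimes> ?d)"
        by (rule path_translate[OF K]) (use n M it s y in \<open>auto simp: char_mult algebra_simps\<close>)
      moreover have "(i ?s \<otimes> j y) \<otimes> ?d = j y \<otimes> i ?s"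
        using s(1) y by (simp add: mixed_swap H.m_assoc H.cancel_left)
      ultimately have "path c (i t [^] n \<otimes> j y) (j y \<otimes> i t [^] n)"
        using s y it by simp
      moreover have "path c (i t [^] n) (i t [^] n \<otimes> j y)" using N n by simp
      ultimately show ?thesis by (meson rtrancl_trans)
    qed
    thus ?thesis by blast
  qed
  thus ?thesis using jy by (simp add: axis_stab_def)
qed

lemma i_stabilizes_axis_of_i:
  assumes \<psi>: "char_class G (restrict (\<chi> \<circ> i) (carrier G)) \<in> Sigma1 G"
    and t: "t \<in> carrier G" "\<chi> (i t) > 0" and y: "y \<in> carrier G"
  shows "i y \<in> axis_stab (i t)"
proof -
  let ?\<psi> = "restrict (\<chi> \<circ> i) (carrier G)"
  have "?\<psi> \<in> characters G"
    by (rule pullback_character[OF G.is_group i char]) (use t in \<open>auto intro!: bexI[of _ t]\<close>)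
  then interpret R: cayley_character G ?\<psi> Y
    using gen_G by unfold_locales
  have ty: "y \<in> R.axis_stab t"
    using R.axis_stab_if_in_Sigma1[OF t(1) _ \<psi>] t y by simp
  have lift: "path c (i u) (i v)" if "R.path c u v" for c u v
    by (rule level_steps_hom[OF i _ R.X_carrier _ that]) auto
  have "\<exists>N. \<forall>n\<ge>N. path c (i t [^] (n::nat)) (i y \<otimes> i t [^] n)" for c
  proof -
    obtain N where N: "\<And>n::nat. n \<ge> N \<Longrightarrow> R.path c (t [^]\<^bsub>G\<^esub> n) (y \<otimes>\<^bsub>G\<^esub> t [^]\<^bsub>G\<^esub> n)"
      using R.axis_stabD[OF ty] by blast
    have "path c (i t [^] n) (i y \<otimes> i t [^] n)" if "n \<ge> N" for n :: nat
      using lift[OF N[OF that]] t y by (simp add: I.hom_nat_pow)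
    thus ?thesis by blast
  qed
  thus ?thesis using y by (simp add: axis_stab_def)
qed

text \<open>
  If \<open>\<chi>\<close> is non-zero on each copy and differs on the two copies, then the axes of \<open>i t\<close> and \<open>j s\<close>
  coincide and are stabilised by both copies.
\<close>

lemma in_Sigma1_if_distinct:
  assumes x: "x \<in> carrier G" "\<chi> (i x) \<noteq> \<chi> (j x)"
    and "g \<in> carrier G" "\<chi> (i g) \<noteq> 0" "h \<in> carrier G" "\<chi> (j h) \<noteq> 0"
  shows "char_class H \<chi> \<in> Sigma1 H"
proof -
  interpret S: weakly_commuting_character G H j i Y \<chi> by (rule swapped_character)
  obtain t where t: "t \<in> carrier G" "\<chi> (i t) > 0" using positive_value assms i by blast
  obtain s where s: "s \<in> carrier G" "\<chi> (j s) > 0" using positive_value assms j by blast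
  have stab: "axis_stab u = S.axis_stab u" for u
    by (simp add: axis_stab_def S.axis_stab_def Un_commute)
  have j_stab: "j y \<in> axis_stab (i t)" if "y \<in> carrier G" for y
    by (rule j_stabilizes_axis_of_i[OF x t that])
  have "i y \<in> axis_stab (j s)" if "y \<in> carrier G" for y
    unfolding stab using S.j_stabilizes_axis_of_i[OF x(1) _ s that] x(2) by simp
  moreover have "axis_stab (j s) \<subseteq> axis_stab (i t)"
    using axis_stab_mono[of "j s" "i t"] calculation s t by simp
  ultimately have "i y \<in> axis_stab (i t)" if "y \<in> carrier G" for y
    using that by blast
  thus ?thesis using in_Sigma1_if_stab[of "i t"] t j_stab by simp
qed

lemma in_Sigma1_if_trivial_on_j:
  assumes j0: "\<And>g. g \<in> carrier G \<Longrightarrow> \<chi> (j g) = 0"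
    and \<psi>: "char_class G (restrict (\<chi> \<circ> i) (carrier G)) \<in> Sigma1 G"
    and g: "g \<in> carrier G" "\<chi> (i g) \<noteq> 0"
  shows "char_class H \<chi> \<in> Sigma1 H"
proof -
  obtain t where t: "t \<in> carrier G" "\<chi> (i t) > 0" using positive_value g i by blast
  have "\<chi> (i t) \<noteq> \<chi> (j t)" using t j0 by simp
  thus ?thesis
    using in_Sigma1_if_stab[of "i t"] t i_stabilizes_axis_of_i[OF \<psi> t]
      j_stabilizes_axis_of_i[OF t(1) _ t] by simp
qed

text \<open>If \<open>\<chi>\<close> agrees on the two copies, then \<open>i t\<close> and \<open>j t\<close> share an axis because they commute.\<close>

lemma in_Sigma1_if_equal:
  assumes eq: "\<And>g. g \<in> carrier G \<Longrightarrow> \<chi> (i g) = \<chi> (j g)"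
    and \<psi>: "char_class G (restrict (\<chi> \<circ> i) (carrier G)) \<in> Sigma1 G"
    and g: "g \<in> carrier G" "\<chi> (i g) \<noteq> 0"
  shows "char_class H \<chi> \<in> Sigma1 H"
proof -
  interpret S: weakly_commuting_character G H j i Y \<chi> by (rule swapped_character)
  obtain t where t: "t \<in> carrier G" "\<chi> (i t) > 0" using positive_value g i by blast
  have stab: "axis_stab u = S.axis_stab u" for u
    by (simp add: axis_stab_def S.axis_stab_def Un_commute)
  have "restrict (\<chi> \<circ> i) (carrier G) = restrict (\<chi> \<circ> j) (carrier G)"
    using eq by (auto simp: restrict_def)
  hence "j y \<in> axis_stab (j t)" if "y \<in> carrier G" for y
    unfolding stab using S.i_stabilizes_axis_of_i[of t y] \<psi> t eq that by simp
  moreover have "i t \<in> axis_stab (j t)"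
    using centralizer_axis_stab[of "j t" "i t"] commute t eq by simp
  hence "axis_stab (j t) \<subseteq> axis_stab (i t)"
    using axis_stab_mono[of "j t" "i t"] t eq by simp
  ultimately have "j y \<in> axis_stab (i t)" if "y \<in> carrier G" for y
    using that by blast
  thus ?thesis
    using in_Sigma1_if_stab[of "i t"] t i_stabilizes_axis_of_i[OF \<psi> t] by simp
qed

end

section \<open>Bases of finitely generated torsion-free abelian groups\<close>

context comm_group
begin

text \<open>The integral linear combination of the family \<open>b\<close> with coefficients \<open>k\<close>, in multiplicative notation.\<close>

definition lincomb :: "'i set \<Rightarrow> ('i \<Rightarrow> 'a) \<Rightarrow> ('i \<Rightarrow> int) \<Rightarrow> 'a" where
  "lincomb I b k = (\<Otimes>i\<in>I. b i [^] k i)"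

lemma lincomb_closed [simp]: "b \<in> I \<rightarrow> carrier G \<Longrightarrow> lincomb I b k \<in> carrier G"
  unfolding lincomb_def by (rule finprod_closed) auto

lemma lincomb_cong:
  assumes "b \<in> I \<rightarrow> carrier G" "\<And>i. i \<in> I \<Longrightarrow> c i = b i" "\<And>i. i \<in> I \<Longrightarrow> l i = k i"
  shows "lincomb I c l = lincomb I b k"
  unfolding lincomb_def by (rule finprod_cong') (use assms in auto)

lemma lincomb_insert:
  assumes "finite I" "a \<notin> I" "b \<in> insert a I \<rightarrow> carrier G"
  shows "lincomb (insert a I) b k = b a [^] k a \<otimes> lincomb I b k"
  unfolding lincomb_def by (rule finprod_insert) (use assms in auto)

lemma lincomb_zero: "(\<And>i. i \<in> I \<Longrightarrow> k i = 0) \<Longrightarrow> lincomb I b k = \<one>"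
  unfolding lincomb_def by (rule finprod_one_eqI) simp

lemma lincomb_add:
  assumes "b \<in> I \<rightarrow> carrier G"
  shows "lincomb I b (\<lambda>i. k i + l i) = lincomb I b k \<otimes> lincomb I b l"
proof -
  have "lincomb I b (\<lambda>i. k i + l i) = (\<Otimes>i\<in>I. b i [^] k i \<otimes> b i [^] l i)"
    unfolding lincomb_def by (rule finprod_cong') (use assms in \<open>auto simp: int_pow_mult Pi_iff\<close>)
  also have "\<dots> = lincomb I b k \<otimes> lincomb I b l"
    unfolding lincomb_def by (rule finprod_multf) (use assms in auto)
  finally show ?thesis .
qed

lemma lincomb_minus:
  assumes "b \<in> I \<rightarrow> carrier G"
  shows "lincomb I b (\<lambda>i. - k i) = inv (lincomb I b k)"
proof -
  have "lincomb I b (\<lambda>i. - k i) \<otimes> lincomb I b k = lincomb I b (\<lambda>i. - k i + k i)"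
    by (rule lincomb_add[OF assms, symmetric])
  also have "\<dots> = \<one>" by (rule lincomb_zero) simp
  finally show ?thesis using assms by (simp add: inv_equality)
qed

text \<open>The finite family \<open>b\<close>, indexed by \<open>I\<close>, generates the group.\<close>

definition spans :: "'i set \<Rightarrow> ('i \<Rightarrow> 'a) \<Rightarrow> bool" where
  "spans I b \<longleftrightarrow> finite I \<and> b \<in> I \<rightarrow> carrier G \<and> (\<forall>q\<in>carrier G. \<exists>k. q = lincomb I b k)"

lemma spans_generators:
  assumes "finite X" "X \<subseteq> carrier G" "generate G X = carrier G"
  shows "spans X (\<lambda>x. x)"
proof -
  have b: "(\<lambda>x. x) \<in> X \<rightarrow> carrier G" using assms by auto
  have single: "lincomb X (\<lambda>x. x) (\<lambda>x. if x = h then e else 0) = h [^] e" if h: "h \<in> X" for h e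
  proof -
    have "lincomb X (\<lambda>x. x) (\<lambda>x. if x = h then e else 0) = (\<Otimes>x\<in>X. if x = h then x [^] e else \<one>)"
      unfolding lincomb_def by (rule finprod_cong') (use assms in auto)
    thus ?thesis using finprod_singleton_swap[OF h assms(1), of "\<lambda>x. x [^] e"] assms by auto
  qed
  have "\<exists>k. q = lincomb X (\<lambda>x. x) k" if "q \<in> generate G X" for q
    using that
  proof induction
    case one
    have "\<one> = lincomb X (\<lambda>x. x) (\<lambda>x. 0)" by (rule lincomb_zero[symmetric]) simp
    thus ?case by blast
  next
    case (incl h)
    have "h = lincomb X (\<lambda>x. x) (\<lambda>x. if x = h then 1 else 0)"
      using single[OF incl, of 1] incl assms by (simp add: subset_iff)
    thus ?case by blast
  next
    case (inv h)
    have "inv h = lincomb X (\<lambda>x. x) (\<lambda>x. if x = h then - 1 else 0)"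
      using single[OF inv, of "- 1"] inv assms by (simp add: subset_iff int_pow_neg)
    thus ?case by blast
  next
    case (eng p q)
    thus ?case using lincomb_add[OF b] by metis
  qed
  thus ?thesis using assms b by (simp add: spans_def)
qed

text \<open>Effect of the elementary change of generators that multiplies \<open>b j\<close> by \<open>b i [^] e\<close>.\<close>

lemma lincomb_transvection:
  assumes I: "finite I" "i \<in> I" "j \<in> I" "i \<noteq> j" and b: "b \<in> I \<rightarrow> carrier G"
  shows "lincomb I (b(j := b j \<otimes> b i [^] e)) l = lincomb I b (l(i := l i + e * l j))"
proof -
  define R where "R = I - {i, j}"
  have R: "I = insert i (insert j R)" "finite R" "i \<notin> insert j R" "j \<notin> R"
    using I by (auto simp: R_def)
  have bR: "b i \<in> carrier G" "b j \<in> carrier G" "b \<in> R \<rightarrow> carrier G"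
    using b R by auto
  let ?c = "b(j := b j \<otimes> b i [^] e)"
  have split: "lincomb I d k = d i [^] k i \<otimes> (d j [^] k j \<otimes> lincomb R d k)"
    if "d \<in> insert i (insert j R) \<rightarrow> carrier G" for d k
  proof -
    have "lincomb I d k = d i [^] k i \<otimes> lincomb (insert j R) d k"
      unfolding R(1) by (rule lincomb_insert) (use R that in auto)
    also have "lincomb (insert j R) d k = d j [^] k j \<otimes> lincomb R d k"
      by (rule lincomb_insert) (use R that in auto)
    finally show ?thesis .
  qed
  have "lincomb I ?c l = b i [^] l i \<otimes> ((b j \<otimes> b i [^] e) [^] l j \<otimes> lincomb R ?c l)"
    using split[of ?c l] bR I(4) by (auto simp: Pi_iff)
  also have "lincomb R ?c l = lincomb R b l"
    by (rule lincomb_cong[OF bR(3)]) (use R in auto)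
  also have "b i [^] l i \<otimes> ((b j \<otimes> b i [^] e) [^] l j \<otimes> lincomb R b l) =
      b i [^] (l i + e * l j) \<otimes> (b j [^] l j \<otimes> lincomb R b l)"
    using bR by (simp add: int_pow_distrib int_pow_pow int_pow_mult m_ac)
  also have "lincomb R b l = lincomb R b (l(i := l i + e * l j))"
    by (rule lincomb_cong[OF bR(3)]) (use R in auto)
  also have "b i [^] (l i + e * l j) \<otimes> (b j [^] l j \<otimes> \<dots>) = lincomb I b (l(i := l i + e * l j))"
    using split[of b "l(i := l i + e * l j)"] bR I(4) by (auto simp: Pi_iff)
  finally show ?thesis .
qed

text \<open>
  The Euclidean algorithm on the coefficients of a relation. As long as two coefficients are
  non-zero, an elementary change of generators decreases the sum of their absolute values. A
  relation with a single non-zero coefficient says that a generator is torsion, hence trivial.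
\<close>

lemma relation_reduces_spanning:
  assumes torsion_free: "\<forall>a\<in>carrier G. \<forall>n>0. a [^] (n::nat) = \<one> \<longrightarrow> a = \<one>"
    and "spans I b" "lincomb I b k = \<one>" "\<exists>i\<in>I. k i \<noteq> 0"
  shows "\<exists>J c. J \<subset> I \<and> spans J c"
  using assms(2-)
proof (induction "\<Sum>i\<in>I. nat \<bar>k i\<bar>" arbitrary: b k rule: less_induct)
  case less
  have I: "finite I" and b: "b \<in> I \<rightarrow> carrier G" and span: "\<And>q. q \<in> carrier G \<Longrightarrow> \<exists>k. q = lincomb I b k"
    using less.prems by (auto simp: spans_def)
  obtain a where a: "a \<in> I" "k a \<noteq> 0" using less.prems by blast
  show ?case
  proof (cases "\<exists>i\<in>I. i \<noteq> a \<and> k i \<noteq> 0")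
    case False
    define J where "J = I - {a}"
    have J: "I = insert a J" "a \<notin> J" "finite J" "b \<in> insert a J \<rightarrow> carrier G"
      using a I b by (auto simp: J_def)
    have bJ: "b \<in> J \<rightarrow> carrier G" using J(4) by (simp add: Pi_iff)
    have ba: "b a \<in> carrier G" using Pi_mem[OF b a(1)] .
    have "lincomb J b k = \<one>" by (rule lincomb_zero) (use False J in auto)
    hence "b a [^] k a = \<one>"
      using less.prems(2) lincomb_insert[OF J(3,2,4), of k] ba by (simp add: J(1)[symmetric])
    hence ka: "b a [^] k a = \<one>" .
    have "b a [^] nat \<bar>k a\<bar> = \<one>"
    proof (cases "k a < 0")
      case True
      hence "inv (b a [^] nat (- k a)) = \<one>" using ka unfolding int_pow_def2 by simp
      thus ?thesis using True inv_eq_1_iff[of "b a [^] nat (- k a)"] ba by simp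
    next
      case False
      thus ?thesis using ka unfolding int_pow_def2 by simp
    qed
    moreover have "nat \<bar>k a\<bar> > 0" using a(2) by simp
    ultimately have ba1: "b a = \<one>" using torsion_free ba by blast
    have "\<exists>l. q = lincomb J b l" if q: "q \<in> carrier G" for q
    proof -
      obtain l where "q = lincomb I b l" using span q by blast
      also have "\<dots> = lincomb J b l"
        using lincomb_insert[OF J(3,2,4), of l] lincomb_closed[OF bJ, of l] by (simp add: J(1)[symmetric] ba1)
      finally show ?thesis by blast
    qed
    hence "spans J b" using J by (auto simp: spans_def)
    thus ?thesis using J by blast
  next
    case True
    obtain i j where ij: "i \<in> I" "j \<in> I" "i \<noteq> j" "k j \<noteq> 0" "\<bar>k j\<bar> \<le> \<bar>k i\<bar>"
    proof -
      obtain i where i: "i \<in> I" "i \<noteq> a" "k i \<noteq> 0" using True by blast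
      show ?thesis
      proof (cases "\<bar>k a\<bar> \<le> \<bar>k i\<bar>")
        case True
        show ?thesis by (rule that[OF i(1) a(1) i(2) a(2) True])
      next
        case False
        hence "\<bar>k i\<bar> \<le> \<bar>k a\<bar>" by simp
        thus ?thesis using that[OF a(1) i(1) i(2)[symmetric] i(3)] by simp
      qed
    qed
    \<comment> \<open>The sign makes the new coefficient of \<open>b i\<close> smaller by \<open>\<bar>k j\<bar>\<close> in absolute value.\<close>
    define e where "e = sgn (k i) * sgn (k j)"
    define c where "c = b(j := b j \<otimes> b i [^] e)"
    define l where "l = k(i := k i - e * k j)"
    have c: "c \<in> I \<rightarrow> carrier G" using b ij(1,2) by (auto simp: c_def Pi_iff)
    note tv = lincomb_transvection[OF I ij(1-3) b, of e, folded c_def]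
    have "lincomb I c m = lincomb I b (m(i := m i + e * m j))" for m by (rule tv)
    hence shift: "lincomb I c (m(i := m i - e * m j)) = lincomb I b m" for m
      using ij(3) by (simp add: fun_upd_idem)
    have "spans I c"
      unfolding spans_def using I c span shift by metis
    moreover have "lincomb I c l = \<one>" using shift[of k] less.prems(2) by (simp add: l_def)
    moreover have "\<exists>x\<in>I. l x \<noteq> 0" using ij by (auto simp: l_def)
    moreover have "(\<Sum>x\<in>I. nat \<bar>l x\<bar>) < (\<Sum>x\<in>I. nat \<bar>k x\<bar>)"
    proof (rule sum_strict_mono_ex1[OF I])
      have "\<bar>k i - e * k j\<bar> < \<bar>k i\<bar>"
        using ij(4,5) by (auto simp: e_def sgn_if abs_if split: if_splits)
      hence "nat \<bar>l i\<bar> < nat \<bar>k i\<bar>" by (simp add: l_def)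
      thus "\<exists>x\<in>I. nat \<bar>l x\<bar> < nat \<bar>k x\<bar>" using ij by blast
      show "\<forall>x\<in>I. nat \<bar>l x\<bar> \<le> nat \<bar>k x\<bar>"
        using \<open>nat \<bar>l i\<bar> < nat \<bar>k i\<bar>\<close> by (auto simp: l_def)
    qed
    ultimately show ?thesis using less.hyps by blast
  qed
qed

text \<open>A generating family of least cardinality is a basis.\<close>

lemma torsion_free_basis:
  assumes torsion_free: "\<forall>a\<in>carrier G. \<forall>n>0. a [^] (n::nat) = \<one> \<longrightarrow> a = \<one>"
    and X: "finite X" "X \<subseteq> carrier G" "generate G X = carrier G"
  shows "\<exists>n b. b \<in> {..<n} \<rightarrow> carrier G \<and>
    (\<forall>q\<in>carrier G. \<exists>!k. k \<in> {..<n} \<rightarrow>\<^sub>E (UNIV :: int set) \<and> q = (\<Otimes>i\<in>{..<n::nat}. b i [^] k i))"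
proof -
  define P where "P m \<longleftrightarrow> (\<exists>(I :: 'a set) b. spans I b \<and> card I = m)" for m
  have "P (card X)" using spans_generators[OF X] by (auto simp: P_def)
  hence "P (LEAST m. P m)" by (rule LeastI)
  then obtain I :: "'a set" and b where I: "spans I b" "card I = (LEAST m. P m)"
    by (auto simp: P_def)
  have fin: "finite I" and b: "b \<in> I \<rightarrow> carrier G" and span: "\<And>q. q \<in> carrier G \<Longrightarrow> \<exists>k. q = lincomb I b k"
    using I(1) by (auto simp: spans_def)
  have indep: "k i = 0" if rel: "lincomb I b k = \<one>" "i \<in> I" for k i
  proof (rule ccontr)
    assume "k i \<noteq> 0"
    hence "\<exists>i\<in>I. k i \<noteq> 0" using rel by blast
    then obtain J c where J: "J \<subset> I" "spans J c"
      using relation_reduces_spanning[OF torsion_free I(1) rel(1)] by blast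
    hence "P (card J)" by (auto simp: P_def)
    hence "card I \<le> card J" unfolding I(2) by (rule Least_le)
    thus False using psubset_card_mono[OF fin J(1)] by simp
  qed
  define n where "n = card I"
  obtain f where f: "bij_betw f {..<n} I"
    using ex_bij_betw_nat_finite[OF fin] by (auto simp: n_def atLeast0LessThan)
  have re: "lincomb I b k = (\<Otimes>i\<in>{..<n}. b (f i) [^] k (f i))" for k
  proof -
    have "lincomb (f ` {..<n}) b k = (\<Otimes>i\<in>{..<n}. b (f i) [^] k (f i))"
      unfolding lincomb_def
      by (rule finprod_reindex) (use b f in \<open>auto simp: bij_betw_def\<close>)
    thus ?thesis using f by (simp add: bij_betw_def)
  qed
  have bf: "b \<circ> f \<in> {..<n} \<rightarrow> carrier G" using b f by (auto simp: bij_betw_def)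
  have inv_f: "inv_into {..<n} f (f i) = i" if "i < n" for i
    using f that by (simp add: bij_betw_def inv_into_f_f)
  have re': "(\<Otimes>i\<in>{..<n}. (b \<circ> f) i [^] k i) = lincomb I b (\<lambda>x. k (inv_into {..<n} f x))" for k :: "nat \<Rightarrow> int"
    unfolding re by (rule finprod_cong') (use bf inv_f in \<open>auto simp: Pi_iff\<close>)
  have "\<exists>!k. k \<in> {..<n} \<rightarrow>\<^sub>E (UNIV :: int set) \<and> q = (\<Otimes>i\<in>{..<n}. (b \<circ> f) i [^] k i)"
    if q: "q \<in> carrier G" for q
  proof (rule ex_ex1I)
    obtain k where k: "q = lincomb I b k" using span q by blast
    have "q = (\<Otimes>i\<in>{..<n}. (b \<circ> f) i [^] restrict (k \<circ> f) {..<n} i)"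
      unfolding k re by (rule finprod_cong') (use bf in \<open>auto simp: Pi_iff\<close>)
    thus "\<exists>k. k \<in> {..<n} \<rightarrow>\<^sub>E (UNIV :: int set) \<and> q = (\<Otimes>i\<in>{..<n}. (b \<circ> f) i [^] k i)"
      by (intro exI[of _ "restrict (k \<circ> f) {..<n}"]) simp
  next
    fix k l :: "nat \<Rightarrow> int"
    assume k: "k \<in> {..<n} \<rightarrow>\<^sub>E UNIV \<and> q = (\<Otimes>i\<in>{..<n}. (b \<circ> f) i [^] k i)"
      and l: "l \<in> {..<n} \<rightarrow>\<^sub>E UNIV \<and> q = (\<Otimes>i\<in>{..<n}. (b \<circ> f) i [^] l i)"
    let ?g = "inv_into {..<n} f"
    have "lincomb I b (\<lambda>x. k (?g x) + - l (?g x)) =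
        lincomb I b (\<lambda>x. k (?g x)) \<otimes> inv lincomb I b (\<lambda>x. l (?g x))"
      using lincomb_add[OF b] lincomb_minus[OF b] by metis
    also have "\<dots> = q \<otimes> inv q" using k l re' by simp
    finally have "lincomb I b (\<lambda>x. k (?g x) + - l (?g x)) = \<one>" using q by simp
    note zero = indep[OF this]
    have "k i = l i" if "i < n" for i
    proof -
      have "f i \<in> I" using that f by (auto simp: bij_betw_def)
      thus ?thesis using zero[of "f i"] inv_f[OF that] by simp
    qed
    thus "k = l" using k l by (intro PiE_ext[of k "{..<n}" "\<lambda>_. UNIV" l]) auto
  qed
  hence "\<forall>q\<in>carrier G. \<exists>!k. k \<in> {..<n} \<rightarrow>\<^sub>E (UNIV :: int set) \<and> q = (\<Otimes>i\<in>{..<n}. (b \<circ> f) i [^] k i)"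
    by (rule ballI)
  with bf have "b \<circ> f \<in> {..<n} \<rightarrow> carrier G \<and>
    (\<forall>q\<in>carrier G. \<exists>!k. k \<in> {..<n} \<rightarrow>\<^sub>E (UNIV :: int set) \<and> q = (\<Otimes>i\<in>{..<n}. (b \<circ> f) i [^] k i))"
    by (rule conjI)
  thus ?thesis by (intro exI)
qed

end

section \<open>Rational polyhedra in terms of group elements\<close>

lemma (in group) character_derived:
  assumes "\<chi> \<in> characters G" "h \<in> derived G (carrier G)"
  shows "\<chi> h = 0"
proof -
  interpret group_character G \<chi> by unfold_locales (rule assms(1))
  have sub: "derived_set G (carrier G) \<subseteq> carrier G" by (rule derived_set_in_carrier) simp
  show ?thesis using assms(2) unfolding derived_def
  proof induction
    case one
    show ?case by (rule char_one)
  next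
    case (incl h)
    then obtain a b where "a \<in> carrier G" "b \<in> carrier G" "h = a \<otimes> b \<otimes> inv a \<otimes> inv b" by blast
    thus ?case by (simp add: char_mult char_inv)
  next
    case (inv h)
    then obtain a b where "a \<in> carrier G" "b \<in> carrier G" "h = a \<otimes> b \<otimes> inv a \<otimes> inv b" by blast
    thus ?case by (simp add: char_mult char_inv)
  next
    case (eng a b)
    thus ?case using generate_in_carrier[OF sub] by (simp add: char_mult)
  qed
qed

lemma (in comm_group) torsion_subgroup: "subgroup (torsion G) G"
proof (rule subgroupI)
  show "torsion G \<subseteq> carrier G" by (auto simp: torsion_def)
  show "torsion G \<noteq> {}" by (auto simp: torsion_def intro!: exI[of _ \<one>] exI[of _ "1::nat"])
next
  fix a assume "a \<in> torsion G"
  thus "inv a \<in> torsion G" by (auto simp: torsion_def nat_pow_inv)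
next
  fix a b assume "a \<in> torsion G" "b \<in> torsion G"
  then obtain m n :: nat where a: "a \<in> carrier G" "m > 0" "a [^] m = \<one>"
    and b: "b \<in> carrier G" "n > 0" "b [^] n = \<one>" by (auto simp: torsion_def)
  have "a [^] (m * n) = \<one>" using nat_pow_pow[OF a(1), of m n] a(3) by simp
  moreover have "b [^] (m * n) = \<one>" using nat_pow_pow[OF b(1), of n m] b(3) by (simp add: mult.commute)
  ultimately have "(a \<otimes> b) [^] (m * n) = \<one>" using a(1) b(1) by (simp add: pow_mult_distrib m_comm)
  thus "a \<otimes> b \<in> torsion G" using a b by (auto simp: torsion_def intro!: exI[of _ "m * n"])
qed

lemma (in comm_group) torsion_free_mod_torsion:
  assumes "q \<in> carrier (G Mod torsion G)" "n > 0"
    "q [^]\<^bsub>G Mod torsion G\<^esub> (n::nat) = \<one>\<^bsub>G Mod torsion G\<^esub>"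
  shows "q = \<one>\<^bsub>G Mod torsion G\<^esub>"
proof -
  interpret T: normal "torsion G" G
    using torsion_subgroup by (simp add: normal_iff_subgroup)
  obtain a where a: "a \<in> carrier G" "q = torsion G #> a"
    using assms(1) by (auto simp: carrier_FactGroup)
  have coset: "torsion G #> a [^] n = torsion G"
    using assms(3) a T.FactGroup_pow[OF a(1), of n] by simp
  have "a [^] n \<in> torsion G #> a [^] n"
    by (rule rcos_self[OF nat_pow_closed[OF a(1)] torsion_subgroup])
  hence "a [^] n \<in> torsion G" unfolding coset .
  then obtain m :: nat where "m > 0" "(a [^] n) [^] m = \<one>" unfolding torsion_def by blast
  hence "n * m > 0" "a [^] (n * m) = \<one>" using a(1) assms(2) nat_pow_pow by simp_all
  hence "a \<in> torsion G" using a(1) unfolding torsion_def by blast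
  thus ?thesis using coset_join2[OF a(1) torsion_subgroup] a(2) by simp
qed

context group
begin

abbreviation proj :: "'a \<Rightarrow> 'a set set" where "proj \<equiv> abel_mod_torsion_proj G"

lemma abelianization_comm_group: "comm_group (abelianization G)"
  unfolding abelianization_def by (rule derived_quot_is_comm_group)

lemma abel_mod_torsion_comm_group: "comm_group (abel_mod_torsion G)"
  unfolding abel_mod_torsion_def
  using comm_group.abelian_FactGroup[OF abelianization_comm_group
      comm_group.torsion_subgroup[OF abelianization_comm_group]] .

lemma proj_hom: "proj \<in> hom G (abel_mod_torsion G)"
  and proj_surj: "proj ` carrier G = carrier (abel_mod_torsion G)"
proof -
  interpret Ab: comm_group "abelianization G" by (rule abelianization_comm_group)
  interpret N: normal "derived G (carrier G)" G by (rule derived_self_is_normal)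
  interpret T: normal "torsion (abelianization G)" "abelianization G"
    using Ab.torsion_subgroup by (simp add: Ab.normal_iff_subgroup)
  have eq: "proj = (\<lambda>A. torsion (abelianization G) #>\<^bsub>abelianization G\<^esub> A) \<circ> (\<lambda>h. derived G (carrier G) #> h)"
    by (rule ext) (simp add: abel_mod_torsion_proj_def)
  show "proj \<in> hom G (abel_mod_torsion G)"
    using Group.hom_compose[OF N.r_coset_hom_Mod[folded abelianization_def] T.r_coset_hom_Mod]
    unfolding eq abel_mod_torsion_def .
  show "proj ` carrier G = carrier (abel_mod_torsion G)"
    unfolding eq abel_mod_torsion_def
    by (simp add: carrier_FactGroup abelianization_def image_comp)
qed

lemma character_eq_if_proj_eq:
  assumes \<chi>: "\<chi> \<in> characters G" and g: "g \<in> carrier G" and h: "h \<in> carrier G" and eq: "proj g = proj h"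
  shows "\<chi> g = \<chi> h"
proof -
  interpret group_character G \<chi> by unfold_locales (rule \<chi>)
  interpret Ab: comm_group "abelianization G" by (rule abelianization_comm_group)
  interpret N: normal "derived G (carrier G)" G by (rule derived_self_is_normal)
  interpret Q: comm_group "abel_mod_torsion G" by (rule abel_mod_torsion_comm_group)
  interpret P: group_hom G "abel_mod_torsion G" proj
    using proj_hom by unfold_locales
  define x where "x = g \<otimes> inv h"
  have x: "x \<in> carrier G" using g h by (simp add: x_def)
  let ?A = "derived G (carrier G) #> x"
  have A: "?A \<in> carrier (abelianization G)"
    using x by (auto simp: abelianization_def carrier_FactGroup)
  have "proj x = \<one>\<^bsub>abel_mod_torsion G\<^esub>" using eq g h by (simp add: x_def)
  hence "torsion (abelianization G) #>\<^bsub>abelianization G\<^esub> ?A = torsion (abelianization G)"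
    by (simp add: abel_mod_torsion_proj_def abel_mod_torsion_def)
  hence "?A \<in> torsion (abelianization G)"
    using Ab.rcos_self[OF A Ab.torsion_subgroup] by simp
  then obtain n :: nat where n: "n > 0" "?A [^]\<^bsub>abelianization G\<^esub> n = \<one>\<^bsub>abelianization G\<^esub>"
    by (auto simp: torsion_def)
  hence "derived G (carrier G) #> x [^] n = derived G (carrier G)"
    using N.FactGroup_pow[OF x, of n] by (simp add: abelianization_def)
  hence "x [^] n \<in> derived G (carrier G)"
    using rcos_self[OF nat_pow_closed[OF x] N.subgroup_axioms, of n] by argo
  hence "\<chi> (x [^] n) = 0" using character_derived[OF \<chi>] by simp
  moreover have "\<chi> (x [^] n) = real n * \<chi> x" using x
    by (induction n) (auto simp: char_one char_mult algebra_simps)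
  ultimately have "\<chi> x = 0" using n by simp
  thus ?thesis using g h by (simp add: x_def char_mult char_inv)
qed

lemma abel_basis_exists:
  assumes "finitely_generated G"
  shows "\<exists>n b. abel_basis G n b"
proof -
  interpret Q: comm_group "abel_mod_torsion G" by (rule abel_mod_torsion_comm_group)
  interpret P: group_hom G "abel_mod_torsion G" proj
    using proj_hom by unfold_locales
  obtain X where X: "finite X" "X \<subseteq> carrier G" "generate G X = carrier G"
    using assms by (auto simp: finitely_generated_def finite_gen_set_def)
  have tf: "\<forall>a\<in>carrier (abel_mod_torsion G). \<forall>n>0.
      a [^]\<^bsub>abel_mod_torsion G\<^esub> (n::nat) = \<one>\<^bsub>abel_mod_torsion G\<^esub> \<longrightarrow> a = \<one>\<^bsub>abel_mod_torsion G\<^esub>"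
    using comm_group.torsion_free_mod_torsion[OF abelianization_comm_group]
    unfolding abel_mod_torsion_def by blast
  have pX: "finite (proj ` X)" "proj ` X \<subseteq> carrier (abel_mod_torsion G)"
    "generate (abel_mod_torsion G) (proj ` X) = carrier (abel_mod_torsion G)"
    using X P.generate_img[OF X(2)] proj_surj by auto
  from Q.torsion_free_basis[OF tf pX] obtain n b where b: "b \<in> {..<n::nat} \<rightarrow> carrier (abel_mod_torsion G)"
    and ex: "\<forall>q\<in>carrier (abel_mod_torsion G). \<exists>!k. k \<in> {..<n} \<rightarrow>\<^sub>E (UNIV :: int set) \<and>
       q = finprod (abel_mod_torsion G) (\<lambda>i. b i [^]\<^bsub>abel_mod_torsion G\<^esub> k i) {..<n}"
    by (elim exE conjE)
  have "\<exists>h\<in>carrier G. proj h = b i" if "i < n" for i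
  proof -
    have "b i \<in> proj ` carrier G" using b that unfolding proj_surj by (simp add: Pi_iff)
    thus ?thesis by (metis imageE)
  qed
  then obtain c where c: "\<And>i. i < n \<Longrightarrow> c i \<in> carrier G" "\<And>i. i < n \<Longrightarrow> proj (c i) = b i"
    by metis
  have eq: "finprod (abel_mod_torsion G) (\<lambda>i. proj (c i) [^]\<^bsub>abel_mod_torsion G\<^esub> k i) {..<n} =
      finprod (abel_mod_torsion G) (\<lambda>i. b i [^]\<^bsub>abel_mod_torsion G\<^esub> k i) {..<n}" for k :: "nat \<Rightarrow> int"
    by (rule Q.finprod_cong') (use b c in \<open>auto simp: Pi_iff\<close>)
  have "abel_basis G n c" unfolding abel_basis_def eq using c ex by simp
  thus ?thesis by blast
qed

text \<open>
  Integral combinations of basis elements are realised in the group itself, where characters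
  can be evaluated on them.
\<close>

lemma integer_combination_lift:
  assumes "\<And>i. i < n \<Longrightarrow> b i \<in> carrier G"
  shows "\<exists>h\<in>carrier G. proj h = finprod (abel_mod_torsion G)
        (\<lambda>i. proj (b i) [^]\<^bsub>abel_mod_torsion G\<^esub> (k i :: int)) {..<n::nat} \<and>
      (\<forall>\<chi>\<in>characters G. \<chi> h = (\<Sum>i<n. of_int (k i) * \<chi> (b i)))"
  using assms
proof (induction n)
  case 0
  interpret Q: comm_group "abel_mod_torsion G" by (rule abel_mod_torsion_comm_group)
  interpret P: group_hom G "abel_mod_torsion G" proj
    using proj_hom by unfold_locales
  have "\<chi> \<one> = 0" if "\<chi> \<in> characters G" for \<chi>
  proof -
    interpret group_character G \<chi> by unfold_locales (rule that)
    show ?thesis by (rule char_one)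
  qed
  thus ?case by (intro bexI[of _ \<one>]) auto
next
  case (Suc n)
  interpret Q: comm_group "abel_mod_torsion G" by (rule abel_mod_torsion_comm_group)
  interpret P: group_hom G "abel_mod_torsion G" proj
    using proj_hom by unfold_locales
  obtain h where h: "h \<in> carrier G" "proj h = finprod (abel_mod_torsion G)
        (\<lambda>i. proj (b i) [^]\<^bsub>abel_mod_torsion G\<^esub> k i) {..<n}"
    "\<And>\<chi>. \<chi> \<in> characters G \<Longrightarrow> \<chi> h = (\<Sum>i<n. of_int (k i) * \<chi> (b i))"
    using Suc by auto
  have bn: "b n \<in> carrier G" using Suc.prems by simp
  have "proj (b n [^] k n \<otimes> h) = finprod (abel_mod_torsion G)
        (\<lambda>i. proj (b i) [^]\<^bsub>abel_mod_torsion G\<^esub> k i) {..<Suc n}"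
    unfolding lessThan_Suc using h bn Suc.prems
    by (subst Q.finprod_insert) (auto simp: P.hom_int_pow)
  moreover have "\<chi> (b n [^] k n \<otimes> h) = (\<Sum>i<Suc n. of_int (k i) * \<chi> (b i))"
    if \<chi>: "\<chi> \<in> characters G" for \<chi>
  proof -
    interpret group_character G \<chi> by unfold_locales (rule \<chi>)
    have nat: "\<chi> (b n [^] m) = real m * \<chi> (b n)" for m :: nat
      using bn by (induction m) (auto simp: char_one char_mult algebra_simps)
    have "\<chi> (b n [^] k n) = of_int (k n) * \<chi> (b n)"
      using bn by (cases "k n" rule: int_cases2) (simp_all add: int_pow_int int_pow_neg_int nat char_inv)
    thus ?thesis using h bn \<chi> by (simp add: char_mult)
  qed
  ultimately show ?case using h bn by (intro bexI[of _ "b n [^] k n \<otimes> h"]) auto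
qed

end

text \<open>
  The classes of the characters that are non-negative at one group element. For a finitely
  generated group these are the
  rationally defined closed semispheres, and in addition the whole sphere, which is
  obtained from the elements that are torsion modulo the derived subgroup.
\<close>

definition half_sphere :: "('a, 'b) monoid_scheme \<Rightarrow> 'a \<Rightarrow> ('a \<Rightarrow> real) set set" where
  "half_sphere H h = {char_class H \<chi> | \<chi>. \<chi> \<in> characters H \<and> \<chi> h \<ge> 0}"

lemma char_class_eqE:
  assumes "\<chi> \<in> characters H" "\<psi> \<in> characters H" "char_class H \<chi> = char_class H \<psi>"
  obtains r where "r > 0" "\<And>h. h \<in> carrier H \<Longrightarrow> \<psi> h = r * \<chi> h"
proof -
  have "(\<chi>, \<psi>) \<in> char_equiv H"
    using eq_equiv_class_iff[OF char_equiv_equiv assms(1,2)] assms(3) by (simp add: char_class_def)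
  thus ?thesis using that by (auto simp: char_equiv_def)
qed

lemma char_class_in_half_sphere:
  assumes "\<chi> \<in> characters H" "h \<in> carrier H"
  shows "char_class H \<chi> \<in> half_sphere H h \<longleftrightarrow> \<chi> h \<ge> 0"
proof
  assume "char_class H \<chi> \<in> half_sphere H h"
  then obtain \<psi> where \<psi>: "\<psi> \<in> characters H" "char_class H \<chi> = char_class H \<psi>" "\<psi> h \<ge> 0"
    by (auto simp: half_sphere_def)
  obtain r where "r > 0" "\<psi> h = r * \<chi> h"
    using char_class_eqE[OF assms(1) \<psi>(1,2)] assms(2) by blast
  thus "\<chi> h \<ge> 0" using \<psi>(3) by (simp add: zero_le_mult_iff)
qed (use assms in \<open>auto simp: half_sphere_def\<close>)

lemma char_sphere_eq: "char_sphere H = char_class H ` characters H"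
  by (auto simp: char_sphere_def quotient_def char_class_def)

lemma rational_common_denominator:
  fixes v :: "nat \<Rightarrow> rat"
  shows "\<exists>d>0. \<exists>z. \<forall>i<n. of_int d * v i = of_int (z i)"
proof -
  define den where "den i = snd (quotient_of (v i))" for i
  define num where "num i = fst (quotient_of (v i))" for i
  have den: "den i > 0" for i by (simp add: den_def quotient_of_denom_pos')
  have v: "v i = of_int (num i) / of_int (den i)" for i
    by (rule quotient_of_div) (simp add: den_def num_def)
  define z where "z i = num i * (\<Prod>j\<in>{..<n} - {i}. den j)" for i
  have "of_int (\<Prod>j<n. den j) * v i = of_int (z i)" if "i < n" for i
  proof -
    have "(\<Prod>j<n. den j) = den i * (\<Prod>j\<in>{..<n} - {i}. den j)"
      using that by (subst prod.remove[of _ i]) auto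
    thus ?thesis using den[of i] by (simp add: v z_def)
  qed
  moreover have "(\<Prod>j<n. den j) > 0" using den by (simp add: prod_pos)
  ultimately show ?thesis by blast
qed

lemma rational_semisphere_is_half_sphere:
  assumes "group H" "rational_semisphere H S"
  shows "\<exists>h\<in>carrier H. S = half_sphere H h"
proof -
  interpret group H by fact
  obtain n b and v :: "nat \<Rightarrow> rat" where b: "abel_basis H n b"
    and S: "S = {char_class H \<chi> | \<chi>. \<chi> \<in> characters H \<and> (\<Sum>i<n. of_rat (v i) * \<chi> (b i)) \<ge> 0}"
    using assms(2) by (auto simp: rational_semisphere_def)
  obtain d z where d: "d > 0" "\<And>i. i < n \<Longrightarrow> of_int d * v i = of_int (z i)"
    using rational_common_denominator[of n v] by blast
  have bc: "b i \<in> carrier H" if "i < n" for i using b that by (simp add: abel_basis_def)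
  obtain h where h: "h \<in> carrier H"
    "\<And>\<chi>. \<chi> \<in> characters H \<Longrightarrow> \<chi> h = (\<Sum>i<n. of_int (z i) * \<chi> (b i))"
    using integer_combination_lift[of n b z] bc by blast
  have "(\<Sum>i<n. of_rat (v i) * \<chi> (b i)) \<ge> 0 \<longleftrightarrow> \<chi> h \<ge> 0" if \<chi>: "\<chi> \<in> characters H" for \<chi>
  proof -
    have "\<chi> h = (\<Sum>i<n. of_int d * (of_rat (v i) * \<chi> (b i)))"
      unfolding h(2)[OF \<chi>]
    proof (rule sum.cong, simp)
      fix i assume "i \<in> {..<n}"
      hence "(of_rat (of_int (z i)) :: real) = of_rat (of_int d * v i)" using d(2) by simp
      hence "real_of_int (z i) = of_int d * of_rat (v i)" by (simp add: of_rat_mult)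
      thus "of_int (z i) * \<chi> (b i) = of_int d * (of_rat (v i) * \<chi> (b i))" by simp
    qed
    also have "\<dots> = of_int d * (\<Sum>i<n. of_rat (v i) * \<chi> (b i))" by (simp add: sum_distrib_left)
    finally show ?thesis using d(1) by (simp add: zero_le_mult_iff)
  qed
  hence "S = half_sphere H h" unfolding S half_sphere_def by blast
  thus ?thesis using h(1) by blast
qed

lemma half_sphere_cases:
  assumes "group H" "finitely_generated H" "h \<in> carrier H"
  shows "half_sphere H h = char_sphere H \<or> rational_semisphere H (half_sphere H h)"
proof -
  interpret group H by fact
  obtain n b where b: "abel_basis H n b" using abel_basis_exists assms(2) by blast
  have bc: "b i \<in> carrier H" if "i < n" for i using b that by (simp add: abel_basis_def)
  have "proj h \<in> carrier (abel_mod_torsion H)" using proj_surj assms(3) by blast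
  then obtain k :: "nat \<Rightarrow> int" where k: "proj h = finprod (abel_mod_torsion H)
      (\<lambda>i. proj (b i) [^]\<^bsub>abel_mod_torsion H\<^esub> k i) {..<n}"
    using b[unfolded abel_basis_def, THEN conjunct2, THEN bspec, THEN ex1_implies_ex] by blast
  obtain g where g: "g \<in> carrier H" "proj g = proj h"
    "\<And>\<chi>. \<chi> \<in> characters H \<Longrightarrow> \<chi> g = (\<Sum>i<n. of_int (k i) * \<chi> (b i))"
    using integer_combination_lift[of n b k] bc k by auto
  have val: "\<chi> h = (\<Sum>i<n. of_int (k i) * \<chi> (b i))" if "\<chi> \<in> characters H" for \<chi>
    using character_eq_if_proj_eq[OF that assms(3) g(1)] g that by simp
  show ?thesis
  proof (cases "\<exists>i<n. k i \<noteq> 0")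
    case True
    have "rational_semisphere H (half_sphere H h)"
      unfolding rational_semisphere_def
      by (rule exI[of _ n], rule exI[of _ b], rule exI[of _ "\<lambda>i. of_int (k i)"])
        (use b True val in \<open>auto simp: half_sphere_def\<close>)
    thus ?thesis ..
  next
    case False
    hence "\<chi> h \<ge> 0" if "\<chi> \<in> characters H" for \<chi>
      using val[OF that] by simp
    hence "half_sphere H h = char_sphere H"
      unfolding half_sphere_def char_sphere_eq by blast
    thus ?thesis ..
  qed
qed

text \<open>
  Rational polyhedra without bases: a finite set \<open>F\<close> of finite sets \<open>I\<close> of group elements describes the
  union over \<open>I\<close> in \<open>F\<close> of the intersections of the half spheres of the elements of \<open>I\<close>.
\<close>

lemma rational_polyhedron_iff:
  assumes "group H" "finitely_generated H"
  shows "rational_polyhedron H (Sigma1_compl H) \<longleftrightarrow>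
    (\<exists>F. finite F \<and> (\<forall>I\<in>F. finite I \<and> I \<subseteq> carrier H) \<and>
      (\<forall>\<chi>\<in>characters H. char_class H \<chi> \<notin> Sigma1 H \<longleftrightarrow> (\<exists>I\<in>F. \<forall>h\<in>I. \<chi> h \<ge> 0)))"
    (is "_ \<longleftrightarrow> ?R")
proof
  assume "rational_polyhedron H (Sigma1_compl H)"
  then obtain F where F: "finite F" "\<And>I. I \<in> F \<Longrightarrow> finite I"
    "\<And>I S. I \<in> F \<Longrightarrow> S \<in> I \<Longrightarrow> rational_semisphere H S"
    and P: "Sigma1_compl H = (\<Union>I\<in>F. char_sphere H \<inter> \<Inter>I)"
    by (auto simp: rational_polyhedron_def)
  obtain f where f: "\<And>S. rational_semisphere H S \<Longrightarrow> f S \<in> carrier H \<and> S = half_sphere H (f S)"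
    using rational_semisphere_is_half_sphere[OF assms(1)] by metis
  have mem: "char_class H \<chi> \<in> S \<longleftrightarrow> \<chi> (f S) \<ge> 0" if "\<chi> \<in> characters H" "I \<in> F" "S \<in> I" for \<chi> S I
    using char_class_in_half_sphere[OF that(1), of "f S"] f[OF F(3)[OF that(2,3)]] by simp
  have main: "char_class H \<chi> \<notin> Sigma1 H \<longleftrightarrow> (\<exists>I\<in>(\<lambda>I. f ` I) ` F. \<forall>h\<in>I. \<chi> h \<ge> 0)"
    if \<chi>: "\<chi> \<in> characters H" for \<chi>
  proof -
    have "char_class H \<chi> \<notin> Sigma1 H \<longleftrightarrow> char_class H \<chi> \<in> Sigma1_compl H"
      using \<chi> by (auto simp: Sigma1_compl_def char_sphere_eq)
    also have "\<dots> \<longleftrightarrow> (\<exists>I\<in>F. \<forall>S\<in>I. char_class H \<chi> \<in> S)"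
      unfolding P using \<chi> by (auto simp: char_sphere_eq)
    also have "\<dots> \<longleftrightarrow> (\<exists>I\<in>F. \<forall>S\<in>I. \<chi> (f S) \<ge> 0)"
      using mem[OF \<chi>] by blast
    finally show ?thesis by simp
  qed
  show ?R
  proof (intro exI conjI)
    show "finite ((\<lambda>I. f ` I) ` F)" using F(1) by simp
    show "\<forall>I\<in>(\<lambda>I. f ` I) ` F. finite I \<and> I \<subseteq> carrier H" using F(2,3) f by fast
    show "\<forall>\<chi>\<in>characters H. char_class H \<chi> \<notin> Sigma1 H \<longleftrightarrow> (\<exists>I\<in>(\<lambda>I. f ` I) ` F. \<forall>h\<in>I. \<chi> h \<ge> 0)"
      using main by (rule ballI)
  qed
next
  assume ?R
  then obtain F where F: "finite F" and sub: "\<forall>I\<in>F. finite I \<and> I \<subseteq> carrier H"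
    and P: "\<forall>\<chi>\<in>characters H. char_class H \<chi> \<notin> Sigma1 H \<longleftrightarrow> (\<exists>I\<in>F. \<forall>h\<in>I. \<chi> h \<ge> 0)"
    by (elim exE conjE)
  \<comment> \<open>Half spheres that are the whole sphere impose no condition and are dropped.\<close>
  define J where "J I = {S \<in> half_sphere H ` I. rational_semisphere H S}" for I
  have mem: "char_class H \<chi> \<in> \<Inter>(J I) \<longleftrightarrow> (\<forall>h\<in>I. \<chi> h \<ge> 0)" if \<chi>: "\<chi> \<in> characters H" and I: "I \<in> F" for \<chi> I
  proof -
    have half: "char_class H \<chi> \<in> half_sphere H h \<longleftrightarrow> \<chi> h \<ge> 0" if "h \<in> I" for h
      using char_class_in_half_sphere[OF \<chi>] sub I that by blast
    have "char_class H \<chi> \<in> \<Inter>(J I) \<longleftrightarrow> (\<forall>h\<in>I. char_class H \<chi> \<in> half_sphere H h)"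
    proof
      assume in_all: "char_class H \<chi> \<in> \<Inter>(J I)"
      show "\<forall>h\<in>I. char_class H \<chi> \<in> half_sphere H h"
      proof
        fix h assume h: "h \<in> I"
        hence "h \<in> carrier H" using sub I by blast
        from half_sphere_cases[OF assms this] show "char_class H \<chi> \<in> half_sphere H h"
        proof
          assume "half_sphere H h = char_sphere H"
          thus ?thesis using \<chi> by (simp add: char_sphere_eq)
        next
          assume "rational_semisphere H (half_sphere H h)"
          thus ?thesis using in_all h by (simp add: J_def)
        qed
      qed
    qed (auto simp: J_def)
    thus ?thesis using half by simp
  qed
  have "Sigma1_compl H = {char_class H \<chi> | \<chi>. \<chi> \<in> characters H \<and> char_class H \<chi> \<notin> Sigma1 H}"
    by (auto simp: Sigma1_compl_def char_sphere_eq)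
  also have "\<dots> = {char_class H \<chi> | \<chi>. \<chi> \<in> characters H \<and> (\<exists>I\<in>F. char_class H \<chi> \<in> \<Inter>(J I))}"
    using P mem by (metis (lifting))
  also have "\<dots> = (\<Union>I\<in>F. char_sphere H \<inter> \<Inter>(J I))"
    unfolding char_sphere_eq by blast
  finally have "Sigma1_compl H = (\<Union>I\<in>J ` F. char_sphere H \<inter> \<Inter>I)" by simp
  moreover have "\<forall>I\<in>J ` F. finite I \<and> (\<forall>S\<in>I. rational_semisphere H S)"
    using sub by (auto simp: J_def)
  moreover have "finite (J ` F)" using F by simp
  ultimately show "rational_polyhedron H (Sigma1_compl H)"
    unfolding rational_polyhedron_def by (intro exI[of _ "J ` F"] conjI)
qed

section \<open>The complement for X(G)\<close>

text \<open>The value in \<open>K\<close> of a word in the two copies of \<open>G\<close>, given maps \<open>f\<close> and \<open>f'\<close> on the copies.\<close>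

definition sidki_eval ::
    "('c, 'd) monoid_scheme \<Rightarrow> ('a \<Rightarrow> 'c) \<Rightarrow> ('a \<Rightarrow> 'c) \<Rightarrow> ('a + 'a) list \<Rightarrow> 'c" where
  "sidki_eval K f f' w = foldr (\<lambda>a x. case_sum f f' a \<otimes>\<^bsub>K\<^esub> x) w \<one>\<^bsub>K\<^esub>"

text \<open>The universal property of \<open>X(G)\<close>.\<close>

lemma sidki_universal:
  assumes G: "group G" and K: "group K" and f: "f \<in> hom G K" and f': "f' \<in> hom G K"
    and commute: "\<And>g. g \<in> carrier G \<Longrightarrow> f g \<otimes>\<^bsub>K\<^esub> f' g = f' g \<otimes>\<^bsub>K\<^esub> f g"
  obtains p where "p \<in> hom (sidki G) K"
    "\<And>g. g \<in> carrier G \<Longrightarrow> p (sidki_class G [Inl g]) = f g"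
    "\<And>g. g \<in> carrier G \<Longrightarrow> p (sidki_class G [Inr g]) = f' g"
proof -
  interpret G: group G by fact
  interpret K: group K by fact
  interpret f: group_hom G K f using f by unfold_locales
  interpret f': group_hom G K f' using f' by unfold_locales
  define ev where "ev = sidki_eval K f f'"
  have ev_simps: "ev [] = \<one>\<^bsub>K\<^esub>" "ev (Inl g # w) = f g \<otimes>\<^bsub>K\<^esub> ev w" "ev (Inr g # w) = f' g \<otimes>\<^bsub>K\<^esub> ev w" for g w
    by (simp_all add: ev_def sidki_eval_def)
  have closed: "ev w \<in> carrier K" if "w \<in> sidki_words G" for w
    using that
  proof (induction w)
    case (Cons a w)
    thus ?case by (cases a) (auto simp: ev_simps)
  qed (simp add: ev_simps)
  have append: "ev (u @ v) = ev u \<otimes>\<^bsub>K\<^esub> ev v" if "u \<in> sidki_words G" "v \<in> sidki_words G" for u v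
    using that
  proof (induction u)
    case (Cons a u)
    thus ?case by (cases a) (auto simp: ev_simps closed K.m_assoc)
  qed (simp add: ev_simps closed)
  have cong: "ev u = ev v" if "(u, v) \<in> sidki_cong G" for u v
    using that
  proof induction
    case (in_context u v p q)
    thus ?case using sidki_cong_words[OF G in_context(1)] by (simp add: append)
  next
    case (commutator g)
    have "f g \<otimes>\<^bsub>K\<^esub> (f' g \<otimes>\<^bsub>K\<^esub> (inv\<^bsub>K\<^esub> f g \<otimes>\<^bsub>K\<^esub> inv\<^bsub>K\<^esub> f' g)) =
        (f g \<otimes>\<^bsub>K\<^esub> f' g) \<otimes>\<^bsub>K\<^esub> inv\<^bsub>K\<^esub> (f' g \<otimes>\<^bsub>K\<^esub> f g)"
      using commutator by (simp add: K.inv_mult_group K.m_assoc)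
    also have "\<dots> = \<one>\<^bsub>K\<^esub>" using commutator commute[of g] by simp
    finally show ?case using commutator by (simp add: ev_simps)
  qed (auto simp: ev_simps)
  define p where "p A = ev (SOME w. w \<in> A)" for A
  have p: "p (sidki_class G w) = ev w" if w: "w \<in> sidki_words G" for w
  proof -
    have "w \<in> sidki_class G w" using w by (auto simp: sidki_class_def intro: sidki_cong.refl)
    hence "(SOME u. u \<in> sidki_class G w) \<in> sidki_class G w" by (rule someI)
    hence "(w, SOME u. u \<in> sidki_class G w) \<in> sidki_cong G" by (simp add: sidki_class_def)
    thus ?thesis using cong by (simp add: p_def)
  qed
  show thesis
  proof (rule that)
    show "p \<in> hom (sidki G) K"
      by (rule homI) (auto simp: sidki_carrier sidki_mult[OF G] p closed append)
  qed (simp_all add: p ev_simps)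
qed

lemma sidki_generate:
  assumes G: "group G" and Y: "finite_gen_set G Y"
  shows "finite_gen_set (sidki G)
    ((\<lambda>g. sidki_class G [Inl g]) ` Y \<union> (\<lambda>g. sidki_class G [Inr g]) ` Y)"
proof -
  interpret G: group G by fact
  interpret S: group "sidki G" by (rule sidki_group[OF G])
  define l where "l = (\<lambda>g. sidki_class G [Inl g])"
  define r where "r = (\<lambda>g. sidki_class G [Inr g])"
  interpret l: group_hom G "sidki G" l
    using sidki_letter_hom(1)[OF G] by unfold_locales (simp add: l_def)
  interpret r: group_hom G "sidki G" r
    using sidki_letter_hom(2)[OF G] by unfold_locales (simp add: r_def)
  have Yc: "Y \<subseteq> carrier G" "generate G Y = carrier G" "finite Y"
    using Y by (auto simp: finite_gen_set_def)
  let ?Z = "l ` Y \<union> r ` Y"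
  have Z: "?Z \<subseteq> carrier (sidki G)" using Yc by auto
  have sub: "subgroup (generate (sidki G) ?Z) (sidki G)" by (rule S.generate_is_subgroup[OF Z])
  have letter: "l g \<in> generate (sidki G) ?Z" "r g \<in> generate (sidki G) ?Z" if "g \<in> carrier G" for g
  proof -
    have "l g \<in> generate (sidki G) (l ` Y)"
      using l.generate_img[OF Yc(1)] Yc(2) that by auto
    thus "l g \<in> generate (sidki G) ?Z" using S.mono_generate[of "l ` Y" ?Z] by blast
    have "r g \<in> generate (sidki G) (r ` Y)"
      using r.generate_img[OF Yc(1)] Yc(2) that by auto
    thus "r g \<in> generate (sidki G) ?Z" using S.mono_generate[of "r ` Y" ?Z] by blast
  qed
  have "sidki_class G w \<in> generate (sidki G) ?Z" if "w \<in> sidki_words G" for w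
    using that
  proof (induction w)
    case Nil
    show ?case using subgroup.one_closed[OF sub] by (simp add: sidki_one)
  next
    case (Cons a w)
    have w: "w \<in> sidki_words G" and a: "[a] \<in> sidki_words G"
      using Cons.prems by (auto simp: sidki_words_def)
    have "sidki_class G [a] \<in> generate (sidki G) ?Z"
      using letter a by (cases a) (auto simp: l_def r_def)
    hence "sidki_class G [a] \<otimes>\<^bsub>sidki G\<^esub> sidki_class G w \<in> generate (sidki G) ?Z"
      using Cons.IH[OF w] subgroup.m_closed[OF sub] by blast
    thus ?case using sidki_mult[OF G a w] by simp
  qed
  hence "generate (sidki G) ?Z = carrier (sidki G)"
    using S.generate_in_carrier[OF Z] by (auto simp: sidki_carrier)
  thus ?thesis using Yc(3) Z by (simp add: finite_gen_set_def l_def r_def)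
qed

lemma additive_vanishes:
  fixes \<phi> :: "'a \<Rightarrow> real"
  assumes "group G" and Y: "finite_gen_set G Y"
    and add: "\<And>g h. g \<in> carrier G \<Longrightarrow> h \<in> carrier G \<Longrightarrow> \<phi> (g \<otimes>\<^bsub>G\<^esub> h) = \<phi> g + \<phi> h"
    and zero: "\<And>y. y \<in> Y \<Longrightarrow> \<phi> y = 0" and g: "g \<in> carrier G"
  shows "\<phi> g = 0"
proof -
  interpret group G by fact
  have sub: "Y \<subseteq> carrier G" and "g \<in> generate G Y" using Y g by (auto simp: finite_gen_set_def)
  have one: "\<phi> \<one>\<^bsub>G\<^esub> = 0" using add[of "\<one>\<^bsub>G\<^esub>" "\<one>\<^bsub>G\<^esub>"] by simp
  from \<open>g \<in> generate G Y\<close> show ?thesis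
  proof induction
    case (inv y)
    have "y \<in> carrier G" using inv sub by auto
    thus ?case using add[of y "inv\<^bsub>G\<^esub> y"] one zero[OF inv] by simp
  next
    case (eng a b)
    thus ?case using generate_in_carrier[OF sub] by (simp add: add)
  qed (simp_all add: one zero)
qed

lemma character_add:
  assumes "group H" "\<chi> \<in> characters H" "g \<in> carrier H" "h \<in> carrier H"
  shows "\<chi> (g \<otimes>\<^bsub>H\<^esub> h) = \<chi> g + \<chi> h"
  using assms by (auto simp: characters_def hom_def real_add_group_def)

lemma character_eqI:
  assumes "group H" "finite_gen_set H X" "\<chi> \<in> characters H" "\<psi> \<in> characters H"
    and "\<And>x. x \<in> X \<Longrightarrow> \<chi> x = \<psi> x" and "h \<in> carrier H"
  shows "\<chi> h = \<psi> h"
  using additive_vanishes[of H X "\<lambda>h. \<chi> h - \<psi> h" h] assms by (simp add: character_add)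

text \<open>The group \<open>X(G)\<close> with \<open>l\<close> and \<open>r\<close> the embeddings of \<open>G\<close> and of its copy.\<close>

locale sidki_pair = G: group G for G +
  fixes Y assumes gen: "finite_gen_set G Y"
begin

definition l where "l g = sidki_class G [Inl g]"
definition r where "r g = sidki_class G [Inr g]"

sublocale S: group "sidki G" by (rule sidki_group[OF G.is_group])

lemma l_hom: "l \<in> hom G (sidki G)" and r_hom: "r \<in> hom G (sidki G)"
  using sidki_letter_hom[OF G.is_group] by (simp_all add: l_def[abs_def] r_def[abs_def])

lemma l_r_commute:
  assumes g: "g \<in> carrier G"
  shows "l g \<otimes>\<^bsub>sidki G\<^esub> r g = r g \<otimes>\<^bsub>sidki G\<^esub> l g"
proof -
  interpret l: group_hom G "sidki G" l using l_hom by unfold_locales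
  interpret r: group_hom G "sidki G" r using r_hom by unfold_locales
  have "sidki_class G [Inl g, Inr g, Inl (inv\<^bsub>G\<^esub> g), Inr (inv\<^bsub>G\<^esub> g)] = sidki_class G []"
    using sidki_class_eq[OF G.is_group] sidki_cong.commutator[OF g] g by simp
  hence "l g \<otimes>\<^bsub>sidki G\<^esub> (r g \<otimes>\<^bsub>sidki G\<^esub> (l (inv\<^bsub>G\<^esub> g) \<otimes>\<^bsub>sidki G\<^esub> r (inv\<^bsub>G\<^esub> g))) = \<one>\<^bsub>sidki G\<^esub>"
    using g by (simp add: l_def r_def sidki_mult[OF G.is_group] sidki_one)
  hence "(l g \<otimes>\<^bsub>sidki G\<^esub> r g) \<otimes>\<^bsub>sidki G\<^esub> inv\<^bsub>sidki G\<^esub> (r g \<otimes>\<^bsub>sidki G\<^esub> l g) = \<one>\<^bsub>sidki G\<^esub>"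
    using g by (simp add: S.inv_mult_group S.m_assoc)
  hence "inv\<^bsub>sidki G\<^esub> (inv\<^bsub>sidki G\<^esub> (r g \<otimes>\<^bsub>sidki G\<^esub> l g)) = l g \<otimes>\<^bsub>sidki G\<^esub> r g"
    by (rule S.inv_equality) (use g in simp_all)
  thus ?thesis using S.inv_inv[of "r g \<otimes>\<^bsub>sidki G\<^esub> l g"] g by simp
qed

sublocale weakly_commuting_homs G "sidki G" l r Y
  using l_hom r_hom l_r_commute gen sidki_generate[OF G.is_group gen]
  by unfold_locales (simp_all add: l_def[abs_def] r_def[abs_def])

text \<open>
  The retractions of \<open>X(G)\<close> onto \<open>G\<close> that are used below are the ones with \<open>(f, f')\<close> equal to \<open>(id, 1)\<close>,
  \<open>(1, id)\<close> and \<open>(id, id)\<close>.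
\<close>

lemma Sigma1_if_factors:
  assumes \<chi>: "\<chi> \<in> characters (sidki G)" and \<psi>: "\<psi> \<in> characters G"
    and f: "f \<in> hom G G" and f': "f' \<in> hom G G"
    and commute: "\<And>g. g \<in> carrier G \<Longrightarrow> f g \<otimes>\<^bsub>G\<^esub> f' g = f' g \<otimes>\<^bsub>G\<^esub> f g"
    and onto: "f ` carrier G \<union> f' ` carrier G \<supseteq> carrier G"
    and l: "\<And>g. g \<in> carrier G \<Longrightarrow> \<chi> (l g) = \<psi> (f g)"
    and r: "\<And>g. g \<in> carrier G \<Longrightarrow> \<chi> (r g) = \<psi> (f' g)"
    and sigma: "char_class (sidki G) \<chi> \<in> Sigma1 (sidki G)"
  shows "char_class G \<psi> \<in> Sigma1 G"
proof -
  obtain p where p: "p \<in> hom (sidki G) G" "\<And>g. g \<in> carrier G \<Longrightarrow> p (l g) = f g"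
    "\<And>g. g \<in> carrier G \<Longrightarrow> p (r g) = f' g"
    by (rule sidki_universal[OF G.is_group G.is_group f f', folded l_def r_def]) (simp_all add: commute)
  interpret p: group_hom "sidki G" G p using p(1) by unfold_locales
  have surj: "p ` carrier (sidki G) = carrier G"
  proof
    show "carrier G \<subseteq> p ` carrier (sidki G)"
    proof
      fix x assume "x \<in> carrier G"
      then obtain g where "g \<in> carrier G" "x = f g \<or> x = f' g" using onto by blast
      thus "x \<in> p ` carrier (sidki G)"
        using p(2,3) I.hom_closed J.hom_closed by (metis imageI)
    qed
  qed auto
  define \<phi> where "\<phi> = restrict (\<psi> \<circ> p) (carrier (sidki G))"
  obtain x where "x \<in> carrier G" "\<psi> x \<noteq> 0" using \<psi> by (auto simp: characters_def)
  hence "\<exists>h\<in>carrier (sidki G). \<psi> (p h) \<noteq> 0" using surj by (metis imageE)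
  hence \<phi>: "\<phi> \<in> characters (sidki G)"
    unfolding \<phi>_def by (rule pullback_character[OF S.is_group p(1) \<psi>])
  have Yc: "Y \<subseteq> carrier G" using gen by (simp add: finite_gen_set_def)
  have "\<chi> x = \<phi> x" if x: "x \<in> l ` Y \<union> r ` Y" for x
  proof -
    obtain y where y: "y \<in> carrier G" "x = l y \<or> x = r y" using x Yc by blast
    hence "\<phi> x = \<psi> (p x)" by (auto simp: \<phi>_def)
    thus ?thesis using y l[OF y(1)] r[OF y(1)] p(2,3)[OF y(1)] by auto
  qed
  from character_eqI[OF S.is_group gen_H \<chi> \<phi> this]
  have eq: "\<psi> (p h) = \<chi> h" if "h \<in> carrier (sidki G)" for h
    using that by (simp add: \<phi>_def)
  show ?thesis
    by (rule Sigma1_quotient[OF G.is_group S.is_group p(1) surj gen_H \<chi> \<psi> eq sigma])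
qed

text \<open>The restrictions of a character of \<open>X(G)\<close> to the two copies of \<open>G\<close>.\<close>

abbreviation res_l where "res_l \<chi> \<equiv> restrict (\<chi> \<circ> l) (carrier G)"
abbreviation res_r where "res_r \<chi> \<equiv> restrict (\<chi> \<circ> r) (carrier G)"

lemma id_hom: "(\<lambda>g. g) \<in> hom G G" and trivial_hom: "(\<lambda>g. \<one>\<^bsub>G\<^esub>) \<in> hom G G"
  by (auto simp: hom_def)

lemma nontrivial_res:
  assumes "\<chi> \<in> characters (sidki G)"
  shows "\<exists>g\<in>carrier G. \<chi> (l g) \<noteq> 0 \<or> \<chi> (r g) \<noteq> 0"
proof (rule ccontr)
  assume "\<not> ?thesis"
  hence zero: "\<And>g. g \<in> carrier G \<Longrightarrow> \<chi> (l g) = 0" "\<And>g. g \<in> carrier G \<Longrightarrow> \<chi> (r g) = 0" by auto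
  have "\<chi> z = 0" if "z \<in> l ` Y \<union> r ` Y" for z
    using that zero gen by (auto simp: finite_gen_set_def subset_iff)
  hence "\<chi> h = 0" if "h \<in> carrier (sidki G)" for h
    using additive_vanishes[OF S.is_group gen_H character_add[OF S.is_group assms]] that by blast
  thus False using assms by (auto simp: characters_def)
qed

text \<open>The description of the complement of \<open>\<Sigma>\<^sup>1(X(G))\<close> in terms of that of \<open>\<Sigma>\<^sup>1(G)\<close>.\<close>

lemma not_in_Sigma1_iff:
  assumes \<chi>: "\<chi> \<in> characters (sidki G)"
  shows "char_class (sidki G) \<chi> \<notin> Sigma1 (sidki G) \<longleftrightarrow>
    (\<forall>g\<in>carrier G. \<chi> (r g) = 0) \<and> char_class G (res_l \<chi>) \<notin> Sigma1 G \<or>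
    (\<forall>g\<in>carrier G. \<chi> (l g) = 0) \<and> char_class G (res_r \<chi>) \<notin> Sigma1 G \<or>
    (\<forall>g\<in>carrier G. \<chi> (l g) = \<chi> (r g)) \<and> char_class G (res_l \<chi>) \<notin> Sigma1 G"
    (is "?N \<longleftrightarrow> ?A \<or> ?B \<or> ?C")
proof -
  interpret W: weakly_commuting_character G "sidki G" l r Y \<chi>
    by unfold_locales (rule \<chi>)
  interpret W': weakly_commuting_character G "sidki G" r l Y \<chi>
    by (rule W.swapped_character)
  have res_l: "res_l \<chi> \<in> characters G" if "g \<in> carrier G" "\<chi> (l g) \<noteq> 0" for g
    by (rule pullback_character[OF G.is_group l_hom \<chi>]) (use that in blast)
  have res_r: "res_r \<chi> \<in> characters G" if "g \<in> carrier G" "\<chi> (r g) \<noteq> 0" for g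
    by (rule pullback_character[OF G.is_group r_hom \<chi>]) (use that in blast)
  obtain g where g: "g \<in> carrier G" "\<chi> (l g) \<noteq> 0 \<or> \<chi> (r g) \<noteq> 0"
    using nontrivial_res[OF \<chi>] by blast
  have zero: "res_l \<chi> \<one>\<^bsub>G\<^esub> = 0" "res_r \<chi> \<one>\<^bsub>G\<^esub> = 0" by (simp_all add: W.char_one)
  have A: "?N \<longleftrightarrow> char_class G (res_l \<chi>) \<notin> Sigma1 G" if 0: "\<forall>g\<in>carrier G. \<chi> (r g) = 0"
  proof -
    have gl: "\<chi> (l g) \<noteq> 0" using g 0 by auto
    have "char_class G (res_l \<chi>) \<in> Sigma1 G" if "char_class (sidki G) \<chi> \<in> Sigma1 (sidki G)"
      by (rule Sigma1_if_factors[OF \<chi> res_l[OF g(1) gl] id_hom trivial_hom _ _ _ _ that])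
        (use 0 zero in auto)
    moreover have "char_class (sidki G) \<chi> \<in> Sigma1 (sidki G)" if "char_class G (res_l \<chi>) \<in> Sigma1 G"
      by (rule W.in_Sigma1_if_trivial_on_j[OF _ that g(1) gl]) (use 0 in auto)
    ultimately show ?thesis by blast
  qed
  have B: "?N \<longleftrightarrow> char_class G (res_r \<chi>) \<notin> Sigma1 G" if 0: "\<forall>g\<in>carrier G. \<chi> (l g) = 0"
  proof -
    have gr: "\<chi> (r g) \<noteq> 0" using g 0 by auto
    have "char_class G (res_r \<chi>) \<in> Sigma1 G" if "char_class (sidki G) \<chi> \<in> Sigma1 (sidki G)"
      by (rule Sigma1_if_factors[OF \<chi> res_r[OF g(1) gr] trivial_hom id_hom _ _ _ _ that])
        (use 0 zero in auto)
    moreover have "char_class (sidki G) \<chi> \<in> Sigma1 (sidki G)" if "char_class G (res_r \<chi>) \<in> Sigma1 G"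
      by (rule W'.in_Sigma1_if_trivial_on_j[OF _ that g(1) gr]) (use 0 in auto)
    ultimately show ?thesis by blast
  qed
  have C: "?N \<longleftrightarrow> char_class G (res_l \<chi>) \<notin> Sigma1 G" if eq: "\<forall>g\<in>carrier G. \<chi> (l g) = \<chi> (r g)"
  proof -
    have gl: "\<chi> (l g) \<noteq> 0" using g eq by auto
    have "char_class G (res_l \<chi>) \<in> Sigma1 G" if "char_class (sidki G) \<chi> \<in> Sigma1 (sidki G)"
      by (rule Sigma1_if_factors[OF \<chi> res_l[OF g(1) gl] id_hom id_hom _ _ _ _ that])
        (use eq in auto)
    moreover have "char_class (sidki G) \<chi> \<in> Sigma1 (sidki G)" if "char_class G (res_l \<chi>) \<in> Sigma1 G"
      by (rule W.in_Sigma1_if_equal[OF _ that g(1) gl]) (use eq in auto)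
    ultimately show ?thesis by blast
  qed
  have D: "\<not> ?N" if "\<not> (\<forall>g\<in>carrier G. \<chi> (r g) = 0)" "\<not> (\<forall>g\<in>carrier G. \<chi> (l g) = 0)"
    "\<not> (\<forall>g\<in>carrier G. \<chi> (l g) = \<chi> (r g))"
    using that W.in_Sigma1_if_distinct by blast
  show ?thesis using A B C D by argo
qed

end

section \<open>Transfer of rational polyhedra\<close>

theorem corollaryB1:
  fixes G :: "('a, 'b) monoid_scheme"
  assumes "group G"
    and "finitely_generated G"
  shows "rational_polyhedron G (Sigma1_compl G) \<longleftrightarrow>
    rational_polyhedron (sidki G) (Sigma1_compl (sidki G))"
proof -
  obtain Y where Y: "finite_gen_set G Y" using assms(2) by (auto simp: finitely_generated_def)
  interpret sidki_pair G Y
    using assms(1) Y by (simp add: sidki_pair_def sidki_pair_axioms_def)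
  have Yc: "Y \<subseteq> carrier G" "generate G Y = carrier G" "finite Y" using Y by (auto simp: finite_gen_set_def)
  note poly_G = rational_polyhedron_iff[OF assms]
  note poly_S = rational_polyhedron_iff[OF S.is_group sidki_finitely_generated[OF assms]]
  show ?thesis
  proof
    assume "rational_polyhedron G (Sigma1_compl G)"
    then obtain F where F: "finite F" "\<forall>I\<in>F. finite I \<and> I \<subseteq> carrier G"
      and P: "\<forall>\<psi>\<in>characters G. char_class G \<psi> \<notin> Sigma1 G \<longleftrightarrow> (\<exists>I\<in>F. \<forall>g\<in>I. \<psi> g \<ge> 0)"
      unfolding poly_G by (elim exE conjE)
    \<comment> \<open>\<open>Zl\<close>, \<open>Zr\<close> and \<open>Zd\<close> cut out the characters that vanish on the first copy, vanish on the second copy,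
      and agree on both copies, respectively.\<close>
    define Zl where "Zl = l ` Y \<union> (\<lambda>y. inv\<^bsub>sidki G\<^esub> l y) ` Y"
    define Zr where "Zr = r ` Y \<union> (\<lambda>y. inv\<^bsub>sidki G\<^esub> r y) ` Y"
    define Zd where "Zd = (\<lambda>y. l y \<otimes>\<^bsub>sidki G\<^esub> inv\<^bsub>sidki G\<^esub> r y) ` Y \<union>
      (\<lambda>y. r y \<otimes>\<^bsub>sidki G\<^esub> inv\<^bsub>sidki G\<^esub> l y) ` Y"
    define E where "E = (\<lambda>I. l ` I \<union> Zr) ` F \<union> (\<lambda>I. r ` I \<union> Zl) ` F \<union> (\<lambda>I. l ` I \<union> Zd) ` F"
    have "char_class (sidki G) \<chi> \<notin> Sigma1 (sidki G) \<longleftrightarrow> (\<exists>I\<in>E. \<forall>h\<in>I. \<chi> h \<ge> 0)"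
      if \<chi>: "\<chi> \<in> characters (sidki G)" for \<chi>
    proof -
      interpret \<chi>: group_character "sidki G" \<chi> by unfold_locales (rule \<chi>)
      have lr: "l y \<in> carrier (sidki G)" "r y \<in> carrier (sidki G)" if "y \<in> Y" for y
        using that Yc(1) by auto
      have vanish: "(\<forall>y\<in>Y. \<phi> y = 0) \<longleftrightarrow> (\<forall>g\<in>carrier G. \<phi> g = 0)"
        if "\<And>g h. g \<in> carrier G \<Longrightarrow> h \<in> carrier G \<Longrightarrow> \<phi> (g \<otimes>\<^bsub>G\<^esub> h) = \<phi> g + \<phi> h" for \<phi> :: "'a \<Rightarrow> real"
        using additive_vanishes[OF G.is_group Y, of \<phi>] that Yc(1) by blast
      have "(\<forall>h\<in>Zl. \<chi> h \<ge> 0) \<longleftrightarrow> (\<forall>y\<in>Y. \<chi> (l y) = 0)"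
        unfolding Zl_def using lr by (auto simp: \<chi>.char_inv ball_Un intro: antisym)
      hence Zl: "(\<forall>h\<in>Zl. \<chi> h \<ge> 0) \<longleftrightarrow> (\<forall>g\<in>carrier G. \<chi> (l g) = 0)"
        using vanish[of "\<lambda>g. \<chi> (l g)"] by (simp add: \<chi>.char_mult)
      have "(\<forall>h\<in>Zr. \<chi> h \<ge> 0) \<longleftrightarrow> (\<forall>y\<in>Y. \<chi> (r y) = 0)"
        unfolding Zr_def using lr by (auto simp: \<chi>.char_inv ball_Un intro: antisym)
      hence Zr: "(\<forall>h\<in>Zr. \<chi> h \<ge> 0) \<longleftrightarrow> (\<forall>g\<in>carrier G. \<chi> (r g) = 0)"
        using vanish[of "\<lambda>g. \<chi> (r g)"] by (simp add: \<chi>.char_mult)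
      have "(\<forall>h\<in>Zd. \<chi> h \<ge> 0) \<longleftrightarrow> (\<forall>y\<in>Y. \<chi> (l y) - \<chi> (r y) = 0)"
        unfolding Zd_def using lr by (auto simp: \<chi>.char_inv \<chi>.char_mult ball_Un intro: antisym)
      hence Zd: "(\<forall>h\<in>Zd. \<chi> h \<ge> 0) \<longleftrightarrow> (\<forall>g\<in>carrier G. \<chi> (l g) = \<chi> (r g))"
        using vanish[of "\<lambda>g. \<chi> (l g) - \<chi> (r g)"] by (simp add: \<chi>.char_mult)
      obtain g where g: "g \<in> carrier G" "\<chi> (l g) \<noteq> 0 \<or> \<chi> (r g) \<noteq> 0"
        using nontrivial_res[OF \<chi>] by blast
      have res_l: "char_class G (res_l \<chi>) \<notin> Sigma1 G \<longleftrightarrow> (\<exists>I\<in>F. \<forall>g\<in>I. \<chi> (l g) \<ge> 0)" if "\<chi> (l g) \<noteq> 0"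
      proof -
        have "res_l \<chi> \<in> characters G"
          by (rule pullback_character[OF G.is_group l_hom \<chi>]) (use that g in blast)
        hence "char_class G (res_l \<chi>) \<notin> Sigma1 G \<longleftrightarrow> (\<exists>I\<in>F. \<forall>g\<in>I. res_l \<chi> g \<ge> 0)"
          using P by (rule bspec[rotated])
        also have "\<dots> \<longleftrightarrow> (\<exists>I\<in>F. \<forall>g\<in>I. \<chi> (l g) \<ge> 0)"
          by (intro bex_cong ball_cong refl) (use F(2) in auto)
        finally show ?thesis .
      qed
      have res_r: "char_class G (res_r \<chi>) \<notin> Sigma1 G \<longleftrightarrow> (\<exists>I\<in>F. \<forall>g\<in>I. \<chi> (r g) \<ge> 0)" if "\<chi> (r g) \<noteq> 0"
      proof -
        have "res_r \<chi> \<in> characters G"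
          by (rule pullback_character[OF G.is_group r_hom \<chi>]) (use that g in blast)
        hence "char_class G (res_r \<chi>) \<notin> Sigma1 G \<longleftrightarrow> (\<exists>I\<in>F. \<forall>g\<in>I. res_r \<chi> g \<ge> 0)"
          using P by (rule bspec[rotated])
        also have "\<dots> \<longleftrightarrow> (\<exists>I\<in>F. \<forall>g\<in>I. \<chi> (r g) \<ge> 0)"
          by (intro bex_cong ball_cong refl) (use F(2) in auto)
        finally show ?thesis .
      qed
      have "(\<exists>I\<in>E. \<forall>h\<in>I. \<chi> h \<ge> 0) \<longleftrightarrow>
          (\<forall>h\<in>Zr. \<chi> h \<ge> 0) \<and> (\<exists>I\<in>F. \<forall>g\<in>I. \<chi> (l g) \<ge> 0) \<or>
          (\<forall>h\<in>Zl. \<chi> h \<ge> 0) \<and> (\<exists>I\<in>F. \<forall>g\<in>I. \<chi> (r g) \<ge> 0) \<or>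
          (\<forall>h\<in>Zd. \<chi> h \<ge> 0) \<and> (\<exists>I\<in>F. \<forall>g\<in>I. \<chi> (l g) \<ge> 0)"
        unfolding E_def bex_Un bex_simps(7) ball_Un ball_simps(9) by blast
      moreover have "\<chi> (l g) \<noteq> 0" if "\<forall>g\<in>carrier G. \<chi> (r g) = 0" using g that by simp
      moreover have "\<chi> (r g) \<noteq> 0" if "\<forall>g\<in>carrier G. \<chi> (l g) = 0" using g that by simp
      moreover have "\<chi> (l g) \<noteq> 0" if "\<forall>g\<in>carrier G. \<chi> (l g) = \<chi> (r g)" using g that by auto
      ultimately show ?thesis
        unfolding not_in_Sigma1_iff[OF \<chi>] Zl Zr Zd using res_l res_r by argo
    qed
    moreover have "finite E" using F(1) by (simp add: E_def)
    moreover have "finite I \<and> I \<subseteq> carrier (sidki G)" if "I \<in> E" for I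
    proof -
      have "Zl \<union> Zr \<union> Zd \<subseteq> carrier (sidki G)" "finite Zl" "finite Zr" "finite Zd"
        using Yc(1,3) by (auto simp: Zl_def Zr_def Zd_def subset_iff)
      moreover obtain J where J: "J \<in> F" "I = l ` J \<union> Zr \<or> I = r ` J \<union> Zl \<or> I = l ` J \<union> Zd"
        using \<open>I \<in> E\<close> by (auto simp: E_def)
      moreover have "l ` J \<subseteq> carrier (sidki G)" "r ` J \<subseteq> carrier (sidki G)" "finite J"
        using F(2)[rule_format, OF J(1)] by auto
      ultimately show ?thesis by (elim disjE) simp_all
    qed
    ultimately show "rational_polyhedron (sidki G) (Sigma1_compl (sidki G))"
      unfolding poly_S by (intro exI[of _ E] conjI ballI) simp_all
  next
    assume "rational_polyhedron (sidki G) (Sigma1_compl (sidki G))"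
    then obtain F where F: "finite F" "\<forall>I\<in>F. finite I \<and> I \<subseteq> carrier (sidki G)"
      and P: "\<forall>\<chi>\<in>characters (sidki G). char_class (sidki G) \<chi> \<notin> Sigma1 (sidki G) \<longleftrightarrow>
        (\<exists>I\<in>F. \<forall>h\<in>I. \<chi> h \<ge> 0)"
      unfolding poly_S by (elim exE conjE)
    \<comment> \<open>Pulling back along the retraction that kills the second copy embeds the sphere of \<open>G\<close>
      so that the complement for \<open>X(G)\<close> restricts to the complement for \<open>G\<close>.\<close>
    obtain p where p: "p \<in> hom (sidki G) G" "\<And>g. g \<in> carrier G \<Longrightarrow> p (l g) = g"
      "\<And>g. g \<in> carrier G \<Longrightarrow> p (r g) = \<one>\<^bsub>G\<^esub>"
      by (rule sidki_universal[OF G.is_group G.is_group id_hom trivial_hom, folded l_def r_def]) simp_all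
    interpret p: group_hom "sidki G" G p using p(1) by unfold_locales
    have "char_class G \<psi> \<notin> Sigma1 G \<longleftrightarrow> (\<exists>I\<in>(\<lambda>I. p ` I) ` F. \<forall>g\<in>I. \<psi> g \<ge> 0)"
      if \<psi>: "\<psi> \<in> characters G" for \<psi>
    proof -
      interpret \<psi>: group_character G \<psi> by unfold_locales (rule \<psi>)
      define \<chi> where "\<chi> = restrict (\<psi> \<circ> p) (carrier (sidki G))"
      have val: "\<chi> (l g) = \<psi> g" "\<chi> (r g) = 0" if "g \<in> carrier G" for g
        using that p(2,3) by (simp_all add: \<chi>_def \<psi>.char_one)
      obtain x where x: "x \<in> carrier G" "\<psi> x \<noteq> 0" using \<psi> by (auto simp: characters_def)
      have \<chi>: "\<chi> \<in> characters (sidki G)"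
        unfolding \<chi>_def
        by (rule pullback_character[OF S.is_group p(1) \<psi>], rule bexI[of _ "l x"]) (use x p(2) in auto)
      have "res_l \<chi> = \<psi>"
        using \<psi> val(1) by (intro extensionalityI[of _ "carrier G"]) (auto simp: characters_def)
      moreover have "\<not> (\<forall>g\<in>carrier G. \<chi> (l g) = 0)" "\<not> (\<forall>g\<in>carrier G. \<chi> (l g) = \<chi> (r g))"
        "\<forall>g\<in>carrier G. \<chi> (r g) = 0" using x val by auto
      ultimately have "char_class G \<psi> \<notin> Sigma1 G \<longleftrightarrow> char_class (sidki G) \<chi> \<notin> Sigma1 (sidki G)"
        using not_in_Sigma1_iff[OF \<chi>] by argo
      also have "\<dots> \<longleftrightarrow> (\<exists>I\<in>F. \<forall>h\<in>I. \<chi> h \<ge> 0)" using P \<chi> by (rule bspec)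
      also have "\<dots> \<longleftrightarrow> (\<exists>I\<in>F. \<forall>h\<in>I. \<psi> (p h) \<ge> 0)"
        by (intro bex_cong ball_cong refl) (use F(2) in \<open>auto simp: \<chi>_def\<close>)
      finally show ?thesis by simp
    qed
    moreover have "finite ((\<lambda>I. p ` I) ` F)" using F(1) by simp
    moreover have "finite I \<and> I \<subseteq> carrier G" if mem: "I \<in> (\<lambda>I. p ` I) ` F" for I
    proof -
      obtain J where J: "J \<in> F" "I = p ` J" using mem by blast
      thus ?thesis using F(2)[rule_format, OF J(1)] by auto
    qed
    ultimately show "rational_polyhedron G (Sigma1_compl G)"
      unfolding poly_G by (intro exI[of _ "(\<lambda>I. p ` I) ` F"] conjI ballI) simp_all
  qed
qed

end
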